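(* There are absolute constants $c_0,c>0$ such that for every $0<\varepsilon\le c_0$ and every triangle-free graph $G=([n],E)$ with $m$ edges, the output $S$ of the following algorithm satisfies $\mathbb E[\mathrm{val}_G(S)]\ge(\frac12+c\,\varepsilon)\mathrm{OPT}_G$. Algorithm: set $d=10000/\varepsilon^2$; for each $v$ let $\hat d(v)=d(v)+\mathrm{Lap}(3/\varepsilon)$ and $\mathcal C=\{v:\hat d(v)>d\}$; let $G_1=(\mathcal C,E_1)$ with $E_1$ the edges of $G$ with both endpoints in $\mathcal C$; sample $S_1^A\in\{\pm1\}^{\mathcal C}$ with $\Pr[S_1^A=\hat S]\propto\exp(\varepsilon\,\mathrm{val}_{G_1}(\hat S)/6)$; let $S_1^B$ be uniform in $\{\pm1\}^{[n]\setminus\mathcal C}$ and $S_1$ the concatenation; let $S_2$ be the output of $\mathcal A_{\varepsilon/3}$ on $G$; output $S_1$ or $S_2$ with probability $1/2$ each. Here $\mathcal A_{\varepsilon'}$: set $\varepsilon_0=\varepsilon'/2$, choose independent uniform $c_1(v),c_2(v)\in\{\pm1\}$, let $\ell(v)=|\{u:\{u,v\}\in E,c_1(u)=c_1(v)\}|$, sample independent $\zeta_v\sim\mathrm{DLap}(1/\varepsilon_0)$, set $c(v)=c_1(v)$ if $\ell(v)-\lceil\frac{d(v)-1}2\rceil+\zeta_v\le0$, else $c(v)=c_2(v)$, and output $c$.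
   Context: $G$ is a simple undirected graph; $d(v)$ its degree. A cut is an assignment in $\{\pm1\}^V$; $\mathrm{val}_H(S)$ is the number of edges of $H$ whose endpoints receive different values, and $\mathrm{OPT}_G$ is the maximum cut size of $G$. $\mathrm{Lap}(b)$ has density $\frac1{2b}e^{-|x|/b}$; $\mathrm{DLap}(1/\varepsilon_0)$ has mass $\frac{e^{\varepsilon_0}-1}{e^{\varepsilon_0}+1}e^{-\varepsilon_0|x|}$ at $x\in\mathbb Z$. *)

theory Defs
  imports "HOL-Probability.Probability"
begin

definition simple_graph :: "nat \<Rightarrow> nat set set \<Rightarrow> bool" where
  "simple_graph n E \<longleftrightarrow> (\<forall>e\<in>E. \<exists>u v. e = {u, v} \<and> u \<noteq> v \<and> u < n \<and> v < n)"

definition triangle_free :: "nat set set \<Rightarrow> bool" where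
  "triangle_free E \<longleftrightarrow> \<not> (\<exists>a b c. {a, b} \<in> E \<and> {b, c} \<in> E \<and> {a, c} \<in> E)"

definition deg :: "nat set set \<Rightarrow> nat \<Rightarrow> nat" where
  "deg E v = card {u. {u, v} \<in> E}"

definition cuts :: "nat set \<Rightarrow> (nat \<Rightarrow> int) set" where
  "cuts V = {S. (\<forall>v\<in>V. S v \<in> {-1, 1}) \<and> (\<forall>v. v \<notin> V \<longrightarrow> S v = 0)}"

definition val :: "nat set set \<Rightarrow> (nat \<Rightarrow> int) \<Rightarrow> nat" where
  "val H S = card {e\<in>H. \<exists>u v. e = {u, v} \<and> S u \<noteq> S v}"

definition OPT :: "nat \<Rightarrow> nat set set \<Rightarrow> nat" where
  "OPT n E = Max (val E ` cuts {..<n})"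

definition induced_edges :: "nat set set \<Rightarrow> nat set \<Rightarrow> nat set set" where
  "induced_edges E C = {e\<in>E. e \<subseteq> C}"

definition lap :: "real \<Rightarrow> real measure" where
  "lap b = density lborel (\<lambda>x. ennreal (exp (- \<bar>x\<bar> / b) / (2 * b)))"

definition dlap :: "real \<Rightarrow> int pmf" where
  "dlap eps0 = embed_pmf (\<lambda>x. (exp eps0 - 1) / (exp eps0 + 1) * exp (- eps0 * \<bar>real_of_int x\<bar>))"

definition expmech :: "nat set set \<Rightarrow> real \<Rightarrow> nat set \<Rightarrow> (nat \<Rightarrow> int) pmf" where
  "expmech E eps C = embed_pmf (\<lambda>S. if S \<in> cuts C then
      exp (eps * real (val (induced_edges E C) S) / 6) /
      (\<Sum>T\<in>cuts C. exp (eps * real (val (induced_edges E C) T) / 6)) else 0)"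

definition S1_pmf :: "nat \<Rightarrow> nat set set \<Rightarrow> real \<Rightarrow> nat set \<Rightarrow> (nat \<Rightarrow> int) pmf" where
  "S1_pmf n E eps C = do {
     SA \<leftarrow> expmech E eps C;
     SB \<leftarrow> pmf_of_set (cuts ({..<n} - C));
     return_pmf (\<lambda>v. if v \<in> C then SA v else SB v) }"

definition alg_A :: "nat \<Rightarrow> nat set set \<Rightarrow> real \<Rightarrow> (nat \<Rightarrow> int) pmf" where
  "alg_A n E eps' = do {
     c1 \<leftarrow> pmf_of_set (cuts {..<n});
     c2 \<leftarrow> pmf_of_set (cuts {..<n});
     \<zeta> \<leftarrow> Pi_pmf {..<n} 0 (\<lambda>_. dlap (eps' / 2));
     return_pmf (\<lambda>v. if v < n then
        (if real (card {u. {u, v} \<in> E \<and> c1 u = c1 v})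
             - real_of_int \<lceil>(real (deg E v) - 1) / 2\<rceil> + real_of_int (\<zeta> v) \<le> 0
         then c1 v else c2 v) else 0) }"

definition noisy_C :: "nat \<Rightarrow> nat set set \<Rightarrow> real \<Rightarrow> (nat \<Rightarrow> real) \<Rightarrow> nat set" where
  "noisy_C n E eps \<omega> = {v\<in>{..<n}. real (deg E v) + \<omega> v > 10000 / eps\<^sup>2}"

definition out_pmf :: "nat \<Rightarrow> nat set set \<Rightarrow> real \<Rightarrow> nat set \<Rightarrow> (nat \<Rightarrow> int) pmf" where
  "out_pmf n E eps C = do {
     b \<leftarrow> bernoulli_pmf (1/2);
     if b then S1_pmf n E eps C else alg_A n E (eps / 3) }"

definition expected_val :: "nat \<Rightarrow> nat set set \<Rightarrow> real \<Rightarrow> real" where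
  "expected_val n E eps =
     (\<integral>\<omega>. measure_pmf.expectation (out_pmf n E eps (noisy_C n E eps \<omega>)) (\<lambda>S. real (val E S))
        \<partial>(PiM {..<n} (\<lambda>_. lap (3 / eps))))"

end

theory Submission imports Defs begin

text \<open>
  For the recolouring algorithm on a triangle-free graph the neighbourhoods of adjacent $u$, $v$ are
  disjoint, so $u$ and $v$ keep their colours independently once it is known whether these agree.
  If $q_v$ and $p_v$ are the probabilities of keeping the colour when the neighbour disagrees or
  agrees, the edge is cut with probability $\frac12 + \frac14(q_u q_v - p_u p_v)$, and
  $q_v - p_v$ is the probability that a binomial plus a discrete Laplace variable hits the
  threshold exactly. For degree $d$ this is always at least a constant times
  $\varepsilon/\sqrt d$, and at least a constant times $\varepsilon$ if $d = O(1/\varepsilon^2)$.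

  The exponential mechanism on $G_1$ has expected value at least $m_1/2$ and, by the Gibbs
  variational principle, at least $\mathrm{OPT}_{G_1} - \frac6\varepsilon |\mathcal C'|$, where
  $\mathcal C'$ is the set of non-isolated vertices of $\mathcal C$. Giving the second bound only
  weight $4 c \varepsilon$ makes the loss $O(c\,|\mathcal C'|)$. The total loss, $O(c)$ for each
  vertex of $\mathcal C'$ and $c\,\varepsilon\, d(v)$ for each $v \notin \mathcal C$, is paid
  vertex by vertex in expectation over the noise by the gain of the recolouring; Markov's
  inequality for the Laplace noise suffices.
\<close>

section \<open>Cuts and degree sums\<close>

lemma cuts_eq_PiE_dflt: "cuts V = PiE_dflt V 0 (\<lambda>_. {-1, 1})"
  by (auto simp: cuts_def PiE_dflt_def)

lemma finite_cuts [simp]: "finite V \<Longrightarrow> finite (cuts V)"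
  by (simp add: cuts_eq_PiE_dflt finite_PiE_dflt)

lemma cuts_nonempty [simp]: "cuts V \<noteq> {}"
  by (simp add: cuts_eq_PiE_dflt)

lemma card_cuts: "finite V \<Longrightarrow> card (cuts V) = 2 ^ card V"
  by (simp add: cuts_eq_PiE_dflt card_PiE_dflt numeral_2_eq_2)

lemma pmf_of_set_cuts:
  assumes "finite V"
  shows "pmf_of_set (cuts V) = Pi_pmf V 0 (\<lambda>_. pmf_of_set {-1, 1})"
  using assms by (simp add: cuts_eq_PiE_dflt Pi_pmf_of_set)

lemma cutsD: "S \<in> cuts V \<Longrightarrow> v \<in> V \<Longrightarrow> S v = -1 \<or> S v = 1"
  by (auto simp: cuts_def)

text \<open>With signs \<open>-1\<close> and \<open>1\<close> on an edge this is \<open>-1\<close>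
  exactly when the edge is cut, so \<open>(1 - edge_prod e S) / 2\<close> is the indicator of a cut
  edge and the mean of \<open>val\<close> reduces to means of products. A product over the set needs
  no order of the endpoints.\<close>

definition edge_prod :: "nat set \<Rightarrow> (nat \<Rightarrow> int) \<Rightarrow> real" where
  "edge_prod e S = (\<Prod>v\<in>e. real_of_int (S v))"

lemma edge_prod_doubleton: "u \<noteq> v \<Longrightarrow> edge_prod {u, v} S = real_of_int (S u) * real_of_int (S v)"
  by (simp add: edge_prod_def)

lemma edge_prod_fun_upd:
  assumes "finite e" "v \<in> e"
  shows "edge_prod e (S(v := - S v)) = - edge_prod e S"
proof -
  have "edge_prod e T = real_of_int (T v) * edge_prod (e - {v}) T" for T
    unfolding edge_prod_def using assms by (rule prod.remove)
  moreover have "edge_prod (e - {v}) (S(v := - S v)) = edge_prod (e - {v}) S"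
    unfolding edge_prod_def by (rule prod.cong) auto
  ultimately show ?thesis by (metis fun_upd_same minus_mult_left of_int_minus)
qed

text \<open>Negating the sign at \<open>v\<close> is an involution of \<open>cuts V\<close>, so an
  odd function cancels in pairs. This is how uniform signs are averaged out below.\<close>

lemma sum_cuts_odd:
  fixes f :: "(nat \<Rightarrow> int) \<Rightarrow> real"
  assumes "v \<in> V" "\<And>S. S \<in> cuts V \<Longrightarrow> f (S(v := - S v)) = - f S"
  shows "(\<Sum>S\<in>cuts V. f S) = 0"
proof -
  have "(\<Sum>S\<in>cuts V. f S) = (\<Sum>S\<in>cuts V. f (S(v := - S v)))"
    by (rule sum.reindex_bij_witness[of _ "\<lambda>S. S(v := - S v)" "\<lambda>S. S(v := - S v)"])
      (use assms(1) in \<open>auto simp: cuts_def\<close>)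
  also have "\<dots> = - (\<Sum>S\<in>cuts V. f S)"
    using assms(2) by (simp add: sum_negf)
  finally show ?thesis by simp
qed

lemma simple_graph_edgeE:
  assumes "simple_graph n E" "e \<in> E"
  obtains u v where "e = {u, v}" "u \<noteq> v" "u < n" "v < n"
  using assms by (auto simp: simple_graph_def)

lemma simple_graph_finite: "simple_graph n E \<Longrightarrow> finite E"
  by (rule finite_subset[of _ "Pow {..<n}"]) (auto simp: simple_graph_def)

lemma simple_graph_Union: "simple_graph n E \<Longrightarrow> \<Union>E \<subseteq> {..<n}"
  by (auto simp: simple_graph_def)

lemma simple_graph_subset: "simple_graph n E \<Longrightarrow> F \<subseteq> E \<Longrightarrow> simple_graph n F"
  by (auto simp: simple_graph_def)

lemma val_eq_sum:
  assumes "simple_graph n H" "\<And>e v. e \<in> H \<Longrightarrow> v \<in> e \<Longrightarrow> S v \<in> {-1, 1}"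
  shows "real (val H S) = (\<Sum>e\<in>H. (1 - edge_prod e S) / 2)"
proof -
  have fin: "finite H" using assms(1) by (rule simple_graph_finite)
  have "(1 - edge_prod e S) / 2 = (if \<exists>u v. e = {u, v} \<and> S u \<noteq> S v then 1 else 0)" if e: "e \<in> H" for e
  proof -
    from assms(1) e obtain u v where uv: "e = {u, v}" "u \<noteq> v"
      by (elim simple_graph_edgeE)
    have "S u = 1 \<or> S u = -1" "S v = 1 \<or> S v = -1" using assms(2)[OF e] uv by auto
    moreover have "(\<exists>u v. e = {u, v} \<and> S u \<noteq> S v) \<longleftrightarrow> S u \<noteq> S v"
      using uv by (auto simp: doubleton_eq_iff)
    ultimately show ?thesis using uv by (auto simp: edge_prod_doubleton)
  qed
  then have "(\<Sum>e\<in>H. (1 - edge_prod e S) / 2) = (\<Sum>e\<in>H. if \<exists>u v. e = {u, v} \<and> S u \<noteq> S v then 1 else 0)"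
    by (rule sum.cong[OF refl])
  also have "\<dots> = real (val H S)"
    using fin by (simp add: val_def sum.If_cases Int_def)
  finally show ?thesis by simp
qed

lemma val_le_card: "finite H \<Longrightarrow> val H S \<le> card H"
  unfolding val_def by (rule card_mono) auto

text \<open>Both sides sum \<open>h v\<close> over all incidences of a vertex with an edge. It turns
  gains and losses found edge by edge into sums over vertices.\<close>

lemma handshake:
  fixes h :: "nat \<Rightarrow> real"
  assumes "simple_graph n E"
  shows "(\<Sum>e\<in>E. \<Sum>v\<in>e. h v) = (\<Sum>v<n. real (deg E v) * h v)"
proof -
  have fin: "finite E" using assms by (rule simple_graph_finite)
  have deg: "deg E v = card {e\<in>E. v \<in> e}" for v
    unfolding deg_def
  proof (rule bij_betw_same_card[of "\<lambda>u. {u, v}"], rule bij_betwI')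
    show "\<exists>u\<in>{u. {u, v} \<in> E}. e = {u, v}" if "e \<in> {e\<in>E. v \<in> e}" for e
      using that assms by (auto elim!: simple_graph_edgeE simp: insert_commute)
  qed (auto simp: doubleton_eq_iff)
  have "(\<Sum>e\<in>E. \<Sum>v\<in>e. h v) = (\<Sum>e\<in>E. \<Sum>v<n. if v \<in> e then h v else 0)"
  proof (rule sum.cong[OF refl])
    fix e assume "e \<in> E"
    then have "{..<n} \<inter> e = e" using assms by (auto elim!: simple_graph_edgeE)
    then show "(\<Sum>v\<in>e. h v) = (\<Sum>v<n. if v \<in> e then h v else 0)"
      by (metis finite_lessThan sum.inter_restrict)
  qed
  also have "\<dots> = (\<Sum>v<n. \<Sum>e\<in>E. if v \<in> e then h v else 0)" by (rule sum.swap)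
  also have "\<dots> = (\<Sum>v<n. real (deg E v) * h v)"
    using fin by (simp add: deg sum.If_cases Int_def)
  finally show ?thesis .
qed

section \<open>The discrete Laplace distribution\<close>

text \<open>A vertex keeps its first colour iff its noise is at most an integer threshold, so the
  noise enters the analysis through this distribution function.\<close>

definition dlap_cdf :: "real \<Rightarrow> int \<Rightarrow> real" where
  "dlap_cdf a j = measure_pmf.prob (dlap a) {..j}"

context
  fixes a :: real
  assumes a: "0 < a"
begin

text \<open>\<open>embed_pmf\<close> has the intended masses once they sum to 1. The non-negative
  and the negative integers give geometric series of ratio \<open>exp (- a)\<close>, starting at
  exponents 0 and 1.\<close>

lemma nn_integral_dlap_density:
  "(\<integral>\<^sup>+ x. ennreal ((exp a - 1) / (exp a + 1) * exp (- a * \<bar>real_of_int x\<bar>)) \<partial>count_space UNIV) = 1"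
proof -
  let ?q = "exp (- a)"
  let ?t = "(exp a - 1) / (exp a + 1)"
  let ?f = "\<lambda>x::int. ennreal (?t * exp (- a * \<bar>real_of_int x\<bar>))"
  have t: "0 \<le> ?t" using a by simp
  have q: "0 < ?q" "?q < 1" using a by auto
  have pow: "exp (- a * real k) = ?q ^ k" for k
    by (simp add: exp_of_nat_mult[symmetric] mult.commute)
  have geo: "(\<integral>\<^sup>+ k. ennreal (?t * exp (- a * real (k + j))) \<partial>count_space UNIV) = ennreal (?t * ?q ^ j / (1 - ?q))" for j
  proof -
    have "(\<lambda>k. ?t * exp (- a * real (k + j))) sums (?t * ?q ^ j * (1 / (1 - ?q)))"
      using sums_mult[OF geometric_sums[of ?q], of "?t * ?q ^ j"] q
      unfolding pow power_add by (simp add: mult_ac)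
    then show ?thesis
      by (subst nn_integral_count_space_nat, subst suminf_ennreal2) (use a in \<open>auto simp: sums_iff\<close>)
  qed
  have split: "(\<integral>\<^sup>+ x. ?f x \<partial>count_space UNIV) =
      (\<integral>\<^sup>+ x. ?f x \<partial>count_space {0..}) + (\<integral>\<^sup>+ x. ?f x \<partial>count_space {..<0})"
  proof -
    have "(\<integral>\<^sup>+ x. ?f x \<partial>count_space UNIV) =
        (\<integral>\<^sup>+ x. ?f x * indicator {0..} x + ?f x * indicator {..<0} x \<partial>count_space UNIV)"
      by (rule nn_integral_cong) (auto split: split_indicator)
    then show ?thesis by (simp add: nn_integral_add nn_integral_count_space_indicator)
  qed
  have nonneg: "(\<integral>\<^sup>+ x. ?f x \<partial>count_space {0..}) = (\<integral>\<^sup>+ k. ennreal (?t * exp (- a * real (k + 0))) \<partial>count_space UNIV)"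
  proof (rule trans[OF nn_integral_bij_count_space[of int UNIV, symmetric]])
    show "bij_betw int UNIV {0..}"
      by (rule bij_betwI[of _ _ _ nat]) auto
  qed simp
  have neg: "(\<integral>\<^sup>+ x. ?f x \<partial>count_space {..<0}) = (\<integral>\<^sup>+ k. ennreal (?t * exp (- a * real (k + 1))) \<partial>count_space UNIV)"
  proof (rule trans[OF nn_integral_bij_count_space[of "\<lambda>k. - int k - 1" UNIV, symmetric]])
    show "bij_betw (\<lambda>k. - int k - 1) UNIV {..<0}"
      by (rule bij_betwI[of _ _ _ "\<lambda>x. nat (- x - 1)"]) auto
  qed (simp add: algebra_simps)
  have "(\<integral>\<^sup>+ x. ?f x \<partial>count_space UNIV) = ennreal (?t * ?q ^ 0 / (1 - ?q)) + ennreal (?t * ?q ^ 1 / (1 - ?q))"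
    unfolding split nonneg neg geo ..
  also have "\<dots> = ennreal (?t / (1 - ?q) + ?t * ?q / (1 - ?q))"
    using t q by (subst ennreal_plus[symmetric]) auto
  also have "?t / (1 - ?q) + ?t * ?q / (1 - ?q) = 1"
  proof -
    have X: "1 < exp a" using a by simp
    have "1 - ?q = (exp a - 1) / exp a" by (simp add: exp_minus field_simps)
    then have "?t / (1 - ?q) = exp a / (exp a + 1)" using X by simp
    moreover have "?t * ?q / (1 - ?q) = ?t / (1 - ?q) * ?q" by simp
    ultimately have "?t / (1 - ?q) + ?t * ?q / (1 - ?q) = exp a / (exp a + 1) + exp a / (exp a + 1) * ?q"
      by simp
    also have "\<dots> = (exp a + 1) / (exp a + 1)"
      unfolding add_divide_distrib by (simp add: exp_minus)
    also have "\<dots> = 1" using X by (intro divide_self) linarith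
    finally show ?thesis .
  qed
  finally show ?thesis by simp
qed

lemma pmf_dlap: "pmf (dlap a) x = (exp a - 1) / (exp a + 1) * exp (- a * \<bar>real_of_int x\<bar>)"
  unfolding dlap_def by (rule pmf_embed_pmf) (use a nn_integral_dlap_density in auto)

lemma dlap_uminus: "map_pmf uminus (dlap a) = dlap a"
proof (rule pmf_eqI)
  fix x :: int
  have "pmf (map_pmf uminus (dlap a)) (- (- x)) = pmf (dlap a) (- x)"
    by (rule pmf_map_inj') (auto simp: inj_def)
  then show "pmf (map_pmf uminus (dlap a)) x = pmf (dlap a) x" by (simp add: pmf_dlap)
qed

lemma dlap_cdf_nonneg: "0 \<le> dlap_cdf a j"
  by (simp add: dlap_cdf_def)

lemma dlap_cdf_mono: "i \<le> j \<Longrightarrow> dlap_cdf a i \<le> dlap_cdf a j"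
  unfolding dlap_cdf_def by (rule measure_pmf.finite_measure_mono) auto

lemma dlap_cdf_diff: "dlap_cdf a j - dlap_cdf a (j - 1) = pmf (dlap a) j"
proof -
  have "{..j} = {..j - 1} \<union> {j}" by auto
  then have "dlap_cdf a j = dlap_cdf a (j - 1) + measure_pmf.prob (dlap a) {j}"
    unfolding dlap_cdf_def by (simp only:) (rule measure_pmf.finite_measure_Union, auto)
  then show ?thesis by (simp add: measure_pmf_single)
qed

text \<open>Symmetry of the noise; the complement of \<open>{..j}\<close> starts at
  \<open>j + 1\<close>, whence the shift by one.\<close>

lemma dlap_cdf_reflect: "dlap_cdf a j + dlap_cdf a (- j - 1) = 1"
proof -
  have "dlap_cdf a (- j - 1) = measure_pmf.prob (map_pmf uminus (dlap a)) {..- j - 1}"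
    by (simp add: dlap_uminus dlap_cdf_def)
  also have "\<dots> = measure_pmf.prob (dlap a) (- {..j})"
    unfolding measure_map_pmf by (rule arg_cong[of _ _ "measure _"]) auto
  also have "\<dots> = 1 - dlap_cdf a j"
    by (simp add: dlap_cdf_def measure_pmf.prob_compl[of "{..j}", simplified] Compl_eq_Diff_UNIV)
  finally show ?thesis by simp
qed

end

text \<open>The numerator is at least \<open>a\<close>, and \<open>exp a <= 2\<close> bounds the
  denominator by 3. The range of \<open>a\<close> fits \<open>a = eps / 6\<close> with
  \<open>eps <= 1\<close>.\<close>

lemma dlap_scale_lower:
  fixes a :: real
  assumes "0 < a" "a \<le> 1/6"
  shows "a / 3 \<le> (exp a - 1) / (exp a + 1)"
proof -
  have "exp a \<le> 2"
  proof -
    have "a\<^sup>2 \<le> (1/6)\<^sup>2" using assms by (intro power_mono) auto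
    then show ?thesis using exp_bound[of a] assms by (simp add: power2_eq_square)
  qed
  then have "a / 3 \<le> (exp a - 1) / 3"
    by (smt (verit) divide_right_mono exp_ge_add_one_self)
  also have "\<dots> \<le> (exp a - 1) / (exp a + 1)"
    using \<open>exp a \<le> 2\<close> assms by (intro divide_left_mono) (auto intro!: mult_pos_pos add_pos_pos)
  finally show ?thesis .
qed

section \<open>Binomial estimates\<close>

text \<open>Consecutive central coefficients have ratio \<open>2 * (2 * n + 1) / (n + 1)\<close>, so
  the induction step reduces to \<open>2 * sqrt n * sqrt (n + 1) <= 2 * n + 1\<close>.\<close>

lemma central_binomial_sqrt_lower:
  assumes "0 < n"
  shows "4 ^ n / (2 * sqrt (real n)) \<le> real (2 * n choose n)"
  using assms
proof (induction n rule: nat_induct_non_zero)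
  case 1
  then show ?case by (simp add: numeral_2_eq_2)
next
  case (Suc n)
  let ?n = "real n"
  have rec: "real (Suc n) * real (2 * Suc n choose Suc n) = 2 * (2 * ?n + 1) * real (2 * n choose n)"
  proof -
    have "Suc n * (2 * Suc n choose Suc n) = 2 * Suc n * (2 * n + 1 choose n)"
      using Suc_times_binomial_eq[of "2 * n + 1" n] by (simp add: algebra_simps)
    moreover have "Suc n * (2 * n + 1 choose n) = (2 * n + 1) * (2 * n choose n)"
      using binomial_symmetric[of n "2 * n + 1"] Suc_times_binomial_eq[of "2 * n" n] by (simp add: algebra_simps)
    ultimately have "Suc n * (2 * Suc n choose Suc n) = 2 * ((2 * n + 1) * (2 * n choose n))"
      by (metis mult.assoc)
    then show ?thesis by (metis (mono_tags, lifting) mult.assoc of_nat_1 of_nat_add of_nat_mult of_nat_numeral)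
  qed
  have "4 * (?n + 1) / (2 * sqrt (?n + 1)) \<le> 2 * (2 * ?n + 1) / (2 * sqrt ?n)"
  proof -
    have "(2 * sqrt ?n * sqrt (?n + 1))\<^sup>2 \<le> (2 * ?n + 1)\<^sup>2"
      by (simp add: power_mult_distrib) (simp add: power2_eq_square algebra_simps)
    then have "2 * sqrt ?n * sqrt (?n + 1) \<le> 2 * ?n + 1"
      by (rule power2_le_imp_le) simp
    moreover have "(?n + 1) / sqrt (?n + 1) = sqrt (?n + 1)"
      by (rule real_div_sqrt) simp
    moreover have "4 * (?n + 1) / (2 * sqrt (?n + 1)) = 2 * ((?n + 1) / sqrt (?n + 1))"
      by (simp only: times_divide_eq_right mult_divide_mult_cancel_left_if[of 2 "2 * (?n + 1)", symmetric])
    ultimately have "4 * (?n + 1) / (2 * sqrt (?n + 1)) = 2 * sqrt (?n + 1)" by simp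
    also have "\<dots> \<le> (2 * ?n + 1) / sqrt ?n"
      using \<open>2 * sqrt ?n * sqrt (?n + 1) \<le> 2 * ?n + 1\<close> \<open>0 < n\<close> by (simp add: pos_le_divide_eq mult_ac)
    also have "\<dots> = 2 * (2 * ?n + 1) / (2 * sqrt ?n)"
      by (rule nonzero_mult_divide_mult_cancel_left[symmetric]) simp
    finally show ?thesis .
  qed
  then have "4 ^ n * (4 * (?n + 1) / (2 * sqrt (?n + 1))) \<le> 4 ^ n * (2 * (2 * ?n + 1) / (2 * sqrt ?n))"
    by (rule mult_left_mono) simp
  also have "\<dots> = 2 * (2 * ?n + 1) * (4 ^ n / (2 * sqrt ?n))" by simp
  also have "\<dots> \<le> 2 * (2 * ?n + 1) * real (2 * n choose n)"
    using Suc.IH by (intro mult_left_mono) auto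
  also have "\<dots> = (?n + 1) * real (2 * Suc n choose Suc n)"
    by (subst rec[symmetric]) (simp only: of_nat_Suc add.commute)
  finally have "4 ^ n * (4 * (?n + 1) / (2 * sqrt (?n + 1))) \<le> (?n + 1) * real (2 * Suc n choose Suc n)" .
  moreover have "(?n + 1) * (4 ^ Suc n / (2 * sqrt (real (Suc n)))) = 4 ^ n * (4 * (?n + 1) / (2 * sqrt (?n + 1)))"
    by (simp only: of_nat_Suc power_Suc add.commute[of 1] times_divide_eq_right mult_ac)
  ultimately have "(?n + 1) * (4 ^ Suc n / (2 * sqrt (real (Suc n)))) \<le> (?n + 1) * real (2 * Suc n choose Suc n)"
    by (simp only:)
  then show ?case by (rule mult_left_le_imp_le) simp
qed

lemma Bernstein_half: "k \<le> n \<Longrightarrow> Bernstein n k (1/2) = real (n choose k) / 2 ^ n"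
  by (simp add: Bernstein_def power_one_over power_add[symmetric] field_simps)

text \<open>\<open>Bernstein (d - 1) i (1/2)\<close> is the mass at \<open>i\<close> of the number
  of agreeing vertices among \<open>d - 1\<close> neighbours with fair signs. The threshold
  \<open>d div 2\<close> is a central value of this binomial for either parity.\<close>

lemma Bernstein_half_center:
  assumes "0 < d"
  shows "1 / (2 * sqrt (real d)) \<le> Bernstein (d - 1) (d div 2) (1/2)"
proof -
  have mono: "1 / (2 * sqrt (real d)) \<le> 1 / (2 * sqrt (real n))" if "0 < n" "n \<le> d" for n
    using that by (intro divide_left_mono) auto
  have central: "1 / (2 * sqrt (real n)) \<le> real (2 * n choose n) / 4 ^ n" if "0 < n" for n
    using central_binomial_sqrt_lower[OF that] by (simp add: field_simps)
  show ?thesis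
  proof (cases "even d")
    case True
    then obtain n where n: "d = 2 * Suc n" using assms by (metis dvd_def mult_0_right not0_implies_Suc not_gr_zero)
    \<comment> \<open>For even \<open>d\<close> the row \<open>d - 1\<close> is odd; its middle
      entry is half the central coefficient of row \<open>d\<close>, which matches the missing
      factor 2 in the power.\<close>
    have "real (2 * Suc n choose Suc n) = 2 * real (Suc (2 * n) choose Suc n)"
      using binomial_symmetric[of "Suc n" "Suc (2 * n)"] by simp
    then have "Bernstein (d - 1) (d div 2) (1/2) = real (2 * Suc n choose Suc n) / 4 ^ Suc n"
      using n by (simp add: Bernstein_half power_mult del: binomial_Suc_Suc)
    then show ?thesis using mono[of "Suc n"] central[of "Suc n"] n by simp
  next
    case False
    then obtain n where n: "d = 2 * n + 1" by (auto elim: oddE)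
    then have eq: "Bernstein (d - 1) (d div 2) (1/2) = real (2 * n choose n) / 4 ^ n"
      by (simp add: Bernstein_half power_mult)
    show ?thesis
    proof (cases "n = 0")
      case False
      then show ?thesis using mono[of n] central[of n] n eq by simp
    qed (use n eq in simp)
  qed
qed

text \<open>The variance is \<open>(d - 1) / 4\<close>, and \<open>d div 2\<close> differs from the
  mean \<open>(d - 1) / 2\<close> by at most 1/2, which adds at most 1/4.\<close>

lemma Bernstein_half_second_moment:
  assumes "0 < d"
  shows "(\<Sum>i\<le>d - 1. (real (d div 2) - real i)\<^sup>2 * Bernstein (d - 1) i (1/2)) \<le> real d / 4"
proof -
  define N where "N = d - 1"
  define m where "m = real (d div 2)"
  let ?B = "\<lambda>i. Bernstein N i (1/2)"
  have d: "real d = real N + 1" using assms by (simp add: N_def)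
  have "(\<Sum>i\<le>N. (m - real i)\<^sup>2 * ?B i) =
      (\<Sum>i\<le>N. real i * (real i - 1) * ?B i + (1 - 2 * m) * (real i * ?B i) + m\<^sup>2 * ?B i)"
    by (rule sum.cong) (auto simp: power2_eq_square algebra_simps)
  also have "\<dots> = real N * (real N - 1) / 4 + (1 - 2 * m) * (real N / 2) + m\<^sup>2"
    by (simp add: sum.distrib sum_distrib_left[symmetric] power2_eq_square)
  also have "\<dots> = real N / 4 + (m - real N / 2)\<^sup>2"
    by (simp add: power2_eq_square algebra_simps add_divide_distrib diff_divide_distrib)
  also have "(m - real N / 2)\<^sup>2 \<le> (1/2)\<^sup>2"
  proof -
    have "\<bar>m - real N / 2\<bar> \<le> 1/2"
    proof -
      have "2 * (d div 2) = d \<or> 2 * (d div 2) + 1 = d" by linarith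
      then have "2 * m = real d \<or> 2 * m + 1 = real d" unfolding m_def by linarith
      then show ?thesis using d unfolding abs_le_iff by linarith
    qed
    then show ?thesis using power_mono[of "\<bar>m - real N / 2\<bar>" "1/2" 2] by simp
  qed
  finally have "(\<Sum>i\<le>N. (m - real i)\<^sup>2 * ?B i) \<le> real N / 4 + (1/2)\<^sup>2" by simp
  also have "\<dots> = real d / 4" unfolding d by (simp add: power2_eq_square)
  finally show ?thesis unfolding N_def m_def .
qed

text \<open>By convexity \<open>exp (- a * y)\<close> lies above its tangent at
  \<open>y = sqrt d\<close>, and the mean absolute deviation from \<open>d div 2\<close> is at most
  \<open>sqrt d\<close>.\<close>

lemma Bernstein_half_exp_lower:
  assumes "0 < d" "0 \<le> a"
  shows "exp (- a * sqrt (real d)) \<le>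
    (\<Sum>i\<le>d - 1. exp (- a * \<bar>real (d div 2) - real i\<bar>) * Bernstein (d - 1) i (1/2))"
proof -
  let ?B = "\<lambda>i. Bernstein (d - 1) i (1/2)"
  let ?s = "sqrt (real d)"
  let ?y = "\<lambda>i. real (d div 2) - real i"
  have s: "0 < ?s" using assms by simp
  have B: "0 \<le> ?B i" for i by (simp add: Bernstein_def)
  \<comment> \<open>An arithmetic-geometric mean bound at scale \<open>sqrt d\<close>: the second
    moment \<open>d / 4\<close> then gives a first absolute moment of at most
    \<open>sqrt d / 2\<close>.\<close>
  have abs: "\<bar>y\<bar> \<le> y\<^sup>2 / ?s + ?s / 4" for y
  proof -
    have "0 \<le> (\<bar>y\<bar> - ?s / 2)\<^sup>2" by simp
    then have "\<bar>y\<bar> * ?s \<le> y\<^sup>2 + ?s * ?s / 4" by (simp add: power2_eq_square algebra_simps)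
    then have "\<bar>y\<bar> * ?s / ?s \<le> (y\<^sup>2 + ?s * ?s / 4) / ?s" using s by (intro divide_right_mono) auto
    then show ?thesis using s by (simp add: add_divide_distrib del: real_sqrt_mult_self)
  qed
  have "(\<Sum>i\<le>d - 1. \<bar>?y i\<bar> * ?B i) \<le> (\<Sum>i\<le>d - 1. ((?y i)\<^sup>2 / ?s + ?s / 4) * ?B i)"
    using abs B by (intro sum_mono mult_right_mono)
  also have "\<dots> = (\<Sum>i\<le>d - 1. (?y i)\<^sup>2 * ?B i) / ?s + ?s / 4 * (\<Sum>i\<le>d - 1. ?B i)"
    unfolding distrib_right sum.distrib sum_distrib_left sum_divide_distrib by simp
  also have "\<dots> \<le> (real d / 4) / ?s + ?s / 4 * 1"
    using Bernstein_half_second_moment[OF assms(1)] s by (intro add_mono divide_right_mono) auto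
  also have "\<dots> = ?s / 2"
  proof -
    have "real d / ?s = ?s" by (simp add: real_div_sqrt)
    then show ?thesis by simp
  qed
  finally have mean: "(\<Sum>i\<le>d - 1. \<bar>?y i\<bar> * ?B i) \<le> ?s" using s by linarith
  have "exp (- a * ?s) \<le> exp (- a * ?s) * (1 + a * ?s - a * (\<Sum>i\<le>d - 1. \<bar>?y i\<bar> * ?B i))"
    using mean assms by (auto simp: mult_left_mono)
  also have "\<dots> = (\<Sum>i\<le>d - 1. exp (- a * ?s) * (1 + (a * ?s - a * \<bar>?y i\<bar>)) * ?B i)"
  proof -
    have "(\<Sum>i\<le>d - 1. exp (- a * ?s) * (1 + (a * ?s - a * \<bar>?y i\<bar>)) * ?B i) =
        (\<Sum>i\<le>d - 1. exp (- a * ?s) * (1 + a * ?s) * ?B i - exp (- a * ?s) * a * (\<bar>?y i\<bar> * ?B i))"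
      by (rule sum.cong) (auto simp: algebra_simps)
    also have "\<dots> = exp (- a * ?s) * (1 + a * ?s) * (\<Sum>i\<le>d - 1. ?B i) -
        exp (- a * ?s) * a * (\<Sum>i\<le>d - 1. \<bar>?y i\<bar> * ?B i)"
      by (simp only: sum_subtractf sum_distrib_left)
    finally show ?thesis by (simp add: algebra_simps)
  qed
  also have "\<dots> \<le> (\<Sum>i\<le>d - 1. exp (- a * \<bar>?y i\<bar>) * ?B i)"
  proof (intro sum_mono mult_right_mono B)
    fix i
    have "exp (- a * ?s) * (1 + (a * ?s - a * \<bar>?y i\<bar>)) \<le> exp (- a * ?s) * exp (a * ?s - a * \<bar>?y i\<bar>)"
      using exp_ge_add_one_self by (intro mult_left_mono) auto
    then show "exp (- a * ?s) * (1 + (a * ?s - a * \<bar>?y i\<bar>)) \<le> exp (- a * \<bar>?y i\<bar>)"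
      by (simp add: exp_add[symmetric])
  qed
  finally show ?thesis .
qed

section \<open>The probability of keeping the first colour\<close>

text \<open>For a vertex of degree \<open>d\<close> one neighbour is singled out, which agrees
  (\<open>k = 1\<close>) or disagrees (\<open>k = 0\<close>), while the other \<open>d - 1\<close>
  agree as fair coins. So \<open>k = 0\<close> gives q_v and \<open>k = 1\<close> gives p_v.\<close>

definition keep_prob :: "real \<Rightarrow> nat \<Rightarrow> nat \<Rightarrow> real" where
  "keep_prob a d k = (\<Sum>i\<le>d - 1. dlap_cdf a (int (d div 2) - int (k + i)) * Bernstein (d - 1) i (1/2))"

lemma expectation_binomial_half:
  fixes f :: "nat \<Rightarrow> real"
  shows "measure_pmf.expectation (binomial_pmf n (1/2)) f = (\<Sum>i\<le>n. f i * Bernstein n i (1/2))"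
  by (simp add: expectation_binomial_pmf' Bernstein_def mult_ac)

context
  fixes a :: real and d :: nat
  assumes a: "0 < a" and d: "0 < d"
begin

lemma keep_prob_nonneg: "0 \<le> keep_prob a d k"
  unfolding keep_prob_def
  by (intro sum_nonneg mult_nonneg_nonneg dlap_cdf_nonneg Bernstein_nonneg a) auto

text \<open>Pair \<open>i\<close> with \<open>d - 1 - i\<close>, which has the same binomial weight.
  The two thresholds add up to \<open>2 * (d div 2) - (d - 1) >= 0\<close>, so by reflection their
  distribution function values add up to at least 1.\<close>

lemma keep_prob_0_ge_half: "1/2 \<le> keep_prob a d 0"
proof -
  define N where "N = d - 1"
  let ?B = "\<lambda>i. Bernstein (N) i (1/2)"
  let ?G = "\<lambda>i. dlap_cdf a (int (d div 2) - int i)"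
  have sym: "?B (N - i) = ?B i" if "i \<le> N" for i
    using binomial_symmetric[OF that] that by (simp add: Bernstein_half)
  have refl: "(\<Sum>i\<le>N. ?G i * ?B i) = (\<Sum>i\<le>N. ?G (N - i) * ?B i)"
    by (rule sum.reindex_bij_witness[of _ "\<lambda>i. N - i" "\<lambda>i. N - i"])
      (auto simp: sym)
  have "1 = (\<Sum>i\<le>N. 1 * ?B i)" by simp
  also have "\<dots> \<le> (\<Sum>i\<le>N. (?G i + ?G (N - i)) * ?B i)"
  proof (intro sum_mono mult_right_mono)
    fix i assume "i \<in> {..N}"
    then have "- (int (d div 2) - int i) - 1 \<le> int (d div 2) - int (N - i)"
      using d by (auto simp: of_nat_diff N_def)
    then have "dlap_cdf a (- (int (d div 2) - int i) - 1) \<le> ?G (N - i)"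
      by (rule dlap_cdf_mono[OF a])
    then show "1 \<le> ?G i + ?G (N - i)"
      using dlap_cdf_reflect[OF a, of "int (d div 2) - int i"] by linarith
  qed (simp add: Bernstein_def)
  also have "\<dots> = 2 * (\<Sum>i\<le>N. ?G i * ?B i)"
    using refl by (simp add: distrib_right sum.distrib)
  finally show ?thesis by (simp add: keep_prob_def N_def)
qed

text \<open>One more agreeing neighbour lowers the threshold by one, so the two distribution
  functions differ by a single point mass.\<close>

lemma keep_prob_diff:
  "keep_prob a d 0 - keep_prob a d 1 =
    (exp a - 1) / (exp a + 1) * (\<Sum>i\<le>d - 1. exp (- a * \<bar>real (d div 2) - real i\<bar>) * Bernstein (d - 1) i (1/2))"
proof -
  have "dlap_cdf a (int (d div 2) - int (0 + i)) - dlap_cdf a (int (d div 2) - int (1 + i)) =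
      (exp a - 1) / (exp a + 1) * exp (- a * \<bar>real (d div 2) - real i\<bar>)" for i
    using dlap_cdf_diff[OF a, of "int (d div 2) - int i"]
    by (simp add: pmf_dlap[OF a] algebra_simps del: of_nat_div)
  then show ?thesis
    unfolding keep_prob_def sum_subtractf[symmetric] left_diff_distrib[symmetric]
    by (simp add: sum_distrib_left mult.assoc del: of_nat_add)
qed

text \<open>Meant for degrees with \<open>a * sqrt d\<close> bounded, where the difference is of
  order \<open>a\<close>.\<close>

lemma keep_prob_diff_ge_exp:
  assumes "a \<le> 1/6"
  shows "a / 3 * exp (- a * sqrt (real d)) \<le> keep_prob a d 0 - keep_prob a d 1"
  unfolding keep_prob_diff
  using a assms by (intro mult_mono dlap_scale_lower Bernstein_half_exp_lower d) auto

text \<open>Meant for large degrees: only the central term \<open>i = d div 2\<close> is kept, where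
  the Laplace factor is 1.\<close>

lemma keep_prob_diff_ge_sqrt:
  assumes "a \<le> 1/6"
  shows "a / 3 * (1 / (2 * sqrt (real d))) \<le> keep_prob a d 0 - keep_prob a d 1"
proof -
  let ?f = "\<lambda>i. exp (- a * \<bar>real (d div 2) - real i\<bar>) * Bernstein (d - 1) i (1/2)"
  have "d div 2 \<in> {..d - 1}" using d by auto
  then have "?f (d div 2) \<le> (\<Sum>i\<le>d - 1. ?f i)"
    by (intro member_le_sum) (auto simp: Bernstein_def)
  then have "1 / (2 * sqrt (real d)) \<le> (\<Sum>i\<le>d - 1. ?f i)"
    using Bernstein_half_center[OF d] by simp
  then show ?thesis
    unfolding keep_prob_diff using a assms d by (intro mult_mono dlap_scale_lower) auto
qed

end

section \<open>Independence of random signs\<close>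

text \<open>Components are independent; boundedness supplies integrability, so they may have
  infinite support as \<open>dlap\<close> does.\<close>

lemma expectation_prod_Pi_pmf_bounded:
  fixes f :: "'a \<Rightarrow> 'b \<Rightarrow> real"
  assumes "finite A" "J \<subseteq> A" "\<And>x y. \<bar>f x y\<bar> \<le> B"
  shows "measure_pmf.expectation (Pi_pmf A dflt p) (\<lambda>y. \<Prod>x\<in>J. f x (y x)) =
    (\<Prod>x\<in>J. measure_pmf.expectation (p x) (f x))"
proof -
  let ?M = "measure_pmf (Pi_pmf A dflt p)"
  have fin: "finite J" using assms finite_subset by blast
  have "prob_space.indep_vars ?M (\<lambda>_. count_space UNIV) (\<lambda>x y. y x) J"
    by (rule prob_space.indep_vars_subset[OF _ indep_vars_Pi_pmf[OF assms(1)] assms(2)])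
      (rule measure_pmf.prob_space_axioms)
  then have "prob_space.indep_vars ?M (\<lambda>_. borel) (\<lambda>x y. f x (y x)) J"
    by (rule prob_space.indep_vars_compose2[OF measure_pmf.prob_space_axioms]) simp
  moreover have "integrable ?M (\<lambda>y. f x (y x))" for x
    by (rule measure_pmf.integrable_const_bound[of _ B]) (use assms(3) in auto)
  ultimately have "measure_pmf.expectation (Pi_pmf A dflt p) (\<lambda>y. \<Prod>x\<in>J. f x (y x)) =
      (\<Prod>x\<in>J. measure_pmf.expectation (Pi_pmf A dflt p) (\<lambda>y. f x (y x)))"
    using prob_space.indep_vars_lebesgue_integral[OF measure_pmf.prob_space_axioms fin] by blast
  also have "\<dots> = (\<Prod>x\<in>J. measure_pmf.expectation (p x) (f x))"
  proof (rule prod.cong[OF refl])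
    fix x assume "x \<in> J"
    then have "map_pmf (\<lambda>y. y x) (Pi_pmf A dflt p) = p x"
      using assms by (subst Pi_pmf_component) auto
    then show "measure_pmf.expectation (Pi_pmf A dflt p) (\<lambda>y. f x (y x)) = measure_pmf.expectation (p x) (f x)"
      by (metis integral_map_pmf)
  qed
  finally show ?thesis .
qed

lemma expectation_pair_pmf_times:
  fixes f g :: "_ \<Rightarrow> real"
  assumes "finite (set_pmf p)" "finite (set_pmf q)"
  shows "measure_pmf.expectation (pair_pmf p q) (\<lambda>(x, y). f x * g y) =
    measure_pmf.expectation p f * measure_pmf.expectation q g"
proof -
  have "measure_pmf.expectation (pair_pmf p q) (\<lambda>(x, y). f x * g y) =
      (\<Sum>z\<in>set_pmf p \<times> set_pmf q. pmf (pair_pmf p q) z *\<^sub>R (case z of (x, y) \<Rightarrow> f x * g y))"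
    using assms by (intro integral_measure_pmf) auto
  also have "\<dots> = (\<Sum>x\<in>set_pmf p. pmf p x * f x) * (\<Sum>y\<in>set_pmf q. pmf q y * g y)"
    unfolding sum_product sum.cartesian_product
    by (intro sum.cong refl) (auto simp: pmf_pair)
  also have "\<dots> = measure_pmf.expectation p f * measure_pmf.expectation q g"
    using integral_measure_pmf[OF assms(1), of p f] integral_measure_pmf[OF assms(2), of q g] by simp
  finally show ?thesis .
qed

text \<open>The events \<open>y w = s\<close> are independent fair coins for either sign
  \<open>s\<close>, so the number of agreeing neighbours has the same law whatever the colour of the
  vertex.\<close>

lemma map_card_Pi_pmf_signs:
  assumes "finite A" "M \<subseteq> A" "s \<in> {-1, 1 :: int}"
  shows "map_pmf (\<lambda>y. card {w\<in>M. y w = s}) (Pi_pmf A 0 (\<lambda>_. pmf_of_set {-1, 1})) =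
    binomial_pmf (card M) (1/2)"
proof -
  have finM: "finite M" using assms finite_subset by blast
  have "map_pmf (\<lambda>x. x = s) (pmf_of_set {-1, 1 :: int}) = bernoulli_pmf (1/2)"
  proof -
    have "bij_betw (\<lambda>x. x = s) {-1, 1} UNIV"
      using assms(3) by (auto simp: bij_betw_def inj_on_def UNIV_bool)
    then show ?thesis
      by (subst map_pmf_of_set_bij_betw) (auto simp: bernoulli_pmf_half_conv_pmf_of_set)
  qed
  then have "Pi_pmf M False (\<lambda>_. bernoulli_pmf (1/2)) =
      map_pmf (\<lambda>h. (\<lambda>x. x = s) \<circ> h) (Pi_pmf M 0 (\<lambda>_. pmf_of_set {-1, 1}))"
    using Pi_pmf_map[OF finM, of "\<lambda>x. x = s" 0 False "\<lambda>_. pmf_of_set {-1, 1}"] assms(3) by auto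
  also have "Pi_pmf M 0 (\<lambda>_. pmf_of_set {-1, 1 :: int}) =
      map_pmf (\<lambda>f x. if x \<in> M then f x else 0) (Pi_pmf A 0 (\<lambda>_. pmf_of_set {-1, 1}))"
    using assms by (intro Pi_pmf_subset)
  finally have "binomial_pmf (card M) (1/2) =
      map_pmf (\<lambda>y. card {w\<in>M. (if w \<in> M then y w else 0) = s}) (Pi_pmf A 0 (\<lambda>_. pmf_of_set {-1, 1}))"
    by (subst binomial_pmf_altdef'[OF finM refl, of _ False]) (auto simp: map_pmf_comp o_def)
  moreover have "{w\<in>M. (if w \<in> M then y w else 0) = s} = {w\<in>M. y w = s}" for y :: "_ \<Rightarrow> int"
    by auto
  ultimately show ?thesis by simp
qed

text \<open>The two counts read disjoint coordinates, so splitting the product distribution at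
  \<open>M\<close> makes them independent. \<open>M\<close> and \<open>N\<close> will be the
  neighbourhoods of adjacent vertices.\<close>

lemma expectation_signs_card_times:
  fixes f g :: "nat \<Rightarrow> real"
  assumes "finite A" "M \<subseteq> A" "N \<subseteq> A" "M \<inter> N = {}" "s \<in> {-1, 1 :: int}" "t \<in> {-1, 1}"
  shows "measure_pmf.expectation (Pi_pmf A 0 (\<lambda>_. pmf_of_set {-1, 1}))
      (\<lambda>y. f (card {w\<in>M. y w = s}) * g (card {w\<in>N. y w = t})) =
    measure_pmf.expectation (binomial_pmf (card M) (1/2)) f *
    measure_pmf.expectation (binomial_pmf (card N) (1/2)) g"
proof -
  let ?P = "\<lambda>A. Pi_pmf A 0 (\<lambda>_. pmf_of_set {-1, 1 :: int})"
  have finM: "finite M" using assms finite_subset by blast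
  have fin: "finite (set_pmf (?P B))" if "finite B" for B :: "'a set"
    using that by (simp add: Pi_pmf_of_set finite_PiE_dflt)
  have "?P A = ?P (M \<union> (A - M))" using assms(2) by (simp add: Un_absorb1)
  also have "\<dots> = map_pmf (\<lambda>(y, z) x. if x \<in> M then y x else z x) (pair_pmf (?P M) (?P (A - M)))"
    using assms(1) finM by (intro Pi_pmf_union) auto
  finally have "measure_pmf.expectation (?P A) (\<lambda>y. f (card {w\<in>M. y w = s}) * g (card {w\<in>N. y w = t})) =
      measure_pmf.expectation (pair_pmf (?P M) (?P (A - M)))
        (\<lambda>(y, z). f (card {w\<in>M. (if w \<in> M then y w else z w) = s}) *
                  g (card {w\<in>N. (if w \<in> M then y w else z w) = t}))"
    by (simp add: case_prod_unfold)
  also have "\<dots> = measure_pmf.expectation (pair_pmf (?P M) (?P (A - M)))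
        (\<lambda>(y, z). f (card {w\<in>M. y w = s}) * g (card {w\<in>N. z w = t}))"
  proof -
    have "{w\<in>M. (if w \<in> M then y w else z w) = s} = {w\<in>M. y w = s}"
      "{w\<in>N. (if w \<in> M then y w else z w) = t} = {w\<in>N. z w = t}" for y z :: "_ \<Rightarrow> int"
      using assms(4) by auto
    then show ?thesis by simp
  qed
  also have "\<dots> = measure_pmf.expectation (?P M) (\<lambda>y. f (card {w\<in>M. y w = s})) *
      measure_pmf.expectation (?P (A - M)) (\<lambda>z. g (card {w\<in>N. z w = t}))"
    using assms(1) finM by (intro expectation_pair_pmf_times fin) auto
  also have "measure_pmf.expectation (?P M) (\<lambda>y. f (card {w\<in>M. y w = s})) =
      measure_pmf.expectation (binomial_pmf (card M) (1/2)) f"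
    by (subst map_card_Pi_pmf_signs[OF finM order_refl assms(5), symmetric]) simp
  also have "measure_pmf.expectation (?P (A - M)) (\<lambda>z. g (card {w\<in>N. z w = t})) =
      measure_pmf.expectation (binomial_pmf (card N) (1/2)) g"
    by (subst map_card_Pi_pmf_signs[of "A - M" N t, symmetric]) (use assms in auto)
  finally show ?thesis .
qed

text \<open>Conditioning on the colours of \<open>u\<close> and \<open>v\<close>: the four pairs are
  equally likely and the other signs stay independent and uniform.\<close>

lemma expectation_cuts_two_vertices:
  fixes F :: "(nat \<Rightarrow> int) \<Rightarrow> real"
  assumes "finite V" "u \<in> V" "v \<in> V" "u \<noteq> v"
  shows "measure_pmf.expectation (pmf_of_set (cuts V)) F =
    (\<Sum>s\<in>{-1, 1}. \<Sum>t\<in>{-1, 1}. measure_pmf.expectation (Pi_pmf (V - {u, v}) 0 (\<lambda>_. pmf_of_set {-1, 1}))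
      (\<lambda>y. F (y(v := t, u := s)))) / 4"
proof -
  let ?P = "\<lambda>A. Pi_pmf A 0 (\<lambda>_. pmf_of_set {-1, 1 :: int})"
  let ?W = "V - {u, v}"
  have fin: "finite (set_pmf (?P B))" if "finite B" for B :: "nat set"
    using that by (simp add: Pi_pmf_of_set finite_PiE_dflt)
  have V: "V = insert u (insert v ?W)" using assms by auto
  have "pmf_of_set (cuts V) = ?P (insert u (insert v ?W))"
    using assms(1) V by (simp add: pmf_of_set_cuts)
  also have "\<dots> = pmf_of_set {-1, 1} \<bind> (\<lambda>s. pmf_of_set {-1, 1} \<bind> (\<lambda>t.
      map_pmf (\<lambda>y. y(v := t, u := s)) (?P ?W)))"
    using assms by (simp add: Pi_pmf_insert' map_pmf_def bind_assoc_pmf bind_return_pmf)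
  finally have *: "pmf_of_set (cuts V) = pmf_of_set {-1, 1} \<bind> (\<lambda>s. pmf_of_set {-1, 1} \<bind> (\<lambda>t.
      map_pmf (\<lambda>y. y(v := t, u := s)) (?P ?W)))" .
  have finW: "finite (set_pmf (?P ?W))" using assms(1) by (intro fin) auto
  show ?thesis unfolding *
    by (subst pmf_expectation_bind_pmf_of_set; (subst pmf_expectation_bind_pmf_of_set)?)
      (use finW in \<open>auto simp: add_divide_distrib\<close>)
qed

section \<open>The recolouring algorithm\<close>

lemma ceiling_half_pred: "\<lceil>(real d - 1) / 2\<rceil> = int (d div 2)"
proof (rule ceiling_unique)
  have "2 * (d div 2) = d \<or> 2 * (d div 2) + 1 = d" by linarith
  then have "2 * real (d div 2) = real d \<or> 2 * real (d div 2) + 1 = real d" by linarith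
  then show "real_of_int (int (d div 2)) - 1 < (real d - 1) / 2"
    "(real d - 1) / 2 \<le> real_of_int (int (d div 2))" by auto
qed

definition agree :: "nat set set \<Rightarrow> (nat \<Rightarrow> int) \<Rightarrow> nat \<Rightarrow> nat" where
  "agree E c v = card {u. {u, v} \<in> E \<and> c u = c v}"

text \<open>The output with all randomness fixed; the real-valued test is restated as an integer
  threshold for \<open>z v\<close>, so that \<open>dlap_cdf\<close> applies.\<close>

definition recolour :: "nat \<Rightarrow> nat set set \<Rightarrow> (nat \<Rightarrow> int) \<Rightarrow> (nat \<Rightarrow> int) \<Rightarrow> (nat \<Rightarrow> int) \<Rightarrow> nat \<Rightarrow> int" where
  "recolour n E c1 c2 z v =
    (if v < n then if z v \<le> int (deg E v div 2) - int (agree E c1 v) then c1 v else c2 v else 0)"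

lemma alg_A_eq:
  "alg_A n E (2 * a) = pmf_of_set (cuts {..<n}) \<bind> (\<lambda>c1. pmf_of_set (cuts {..<n}) \<bind> (\<lambda>c2.
    map_pmf (recolour n E c1 c2) (Pi_pmf {..<n} 0 (\<lambda>_. dlap a))))"
proof -
  have "real (card {u. {u, v} \<in> E \<and> c1 u = c1 v}) - real_of_int \<lceil>(real (deg E v) - 1) / 2\<rceil> + real_of_int z \<le> 0
      \<longleftrightarrow> z \<le> int (deg E v div 2) - int (agree E c1 v)" for c1 :: "nat \<Rightarrow> int" and v z
    unfolding ceiling_half_pred agree_def by linarith
  moreover have "2 * a / 2 = a" by simp
  ultimately show ?thesis
    unfolding alg_A_def map_pmf_def recolour_def[abs_def] by (simp only:)
qed

lemma recolour_in_cuts: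
  assumes "c1 \<in> cuts {..<n}" "c2 \<in> cuts {..<n}"
  shows "recolour n E c1 c2 z \<in> cuts {..<n}"
  using assms by (auto simp: recolour_def cuts_def)

lemma finite_set_map_recolour:
  assumes "c1 \<in> cuts {..<n}" "c2 \<in> cuts {..<n}"
  shows "finite (set_pmf (map_pmf (recolour n E c1 c2) p))"
  by (rule finite_subset[of _ "cuts {..<n}"]) (use recolour_in_cuts[OF assms] in auto)

lemma set_alg_A: "set_pmf (alg_A n E (2 * a)) \<subseteq> cuts {..<n}"
  by (auto simp: alg_A_eq recolour_in_cuts)

lemma expectation_dlap_threshold:
  "measure_pmf.expectation (dlap a) (\<lambda>z. if z \<le> j then x else y) =
    dlap_cdf a j * x + (1 - dlap_cdf a j) * (y :: real)"
proof -
  have "(\<lambda>z. if z \<le> j then x else y) = (\<lambda>z. y + (x - y) * indicator {..j} z)" by auto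
  then have "measure_pmf.expectation (dlap a) (\<lambda>z. if z \<le> j then x else y) = y + (x - y) * dlap_cdf a j"
    by (simp only:) (subst Bochner_Integration.integral_add; simp add: dlap_cdf_def measure_pmf.emeasure_finite less_top[symmetric])
  then show ?thesis by (simp add: algebra_simps)
qed

abbreviation keep_cdf :: "real \<Rightarrow> nat set set \<Rightarrow> (nat \<Rightarrow> int) \<Rightarrow> nat \<Rightarrow> real" where
  "keep_cdf a E c v \<equiv> dlap_cdf a (int (deg E v div 2) - int (agree E c v))"

text \<open>Given both colourings, the vertices of \<open>e\<close> use independent noise, so the
  mean factorises into mixtures of \<open>c1 v\<close> and \<open>c2 v\<close>.\<close>

lemma expectation_recolour_edge_prod:
  assumes "c1 \<in> cuts {..<n}" "c2 \<in> cuts {..<n}" "e \<subseteq> {..<n}"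
  shows "measure_pmf.expectation (Pi_pmf {..<n} 0 (\<lambda>_. dlap a)) (\<lambda>z. edge_prod e (recolour n E c1 c2 z)) =
    (\<Prod>v\<in>e. keep_cdf a E c1 v * c1 v + (1 - keep_cdf a E c1 v) * c2 v)"
proof -
  let ?f = "\<lambda>v z. if v < n then real_of_int
    (if z \<le> int (deg E v div 2) - int (agree E c1 v) then c1 v else c2 v) else 0"
  have "edge_prod e (recolour n E c1 c2 z) = (\<Prod>v\<in>e. ?f v (z v))" for z
    unfolding edge_prod_def recolour_def by (rule prod.cong) auto
  moreover have "measure_pmf.expectation (Pi_pmf {..<n} 0 (\<lambda>_. dlap a)) (\<lambda>z. \<Prod>v\<in>e. ?f v (z v)) =
      (\<Prod>v\<in>e. measure_pmf.expectation (dlap a) (?f v))"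
  proof (rule expectation_prod_Pi_pmf_bounded[of _ _ _ 1])
    fix v z
    have "\<bar>c1 v\<bar> \<le> 1" "\<bar>c2 v\<bar> \<le> 1" if "v < n"
      using cutsD[OF assms(1), of v] cutsD[OF assms(2), of v] that by auto
    then show "\<bar>?f v z\<bar> \<le> 1" by auto
  qed (use assms in auto)
  moreover have "measure_pmf.expectation (dlap a) (?f v) =
      keep_cdf a E c1 v * c1 v + (1 - keep_cdf a E c1 v) * c2 v" if "v \<in> e" for v
    using that assms(3) expectation_dlap_threshold[of a _ "real_of_int (c1 v)" "real_of_int (c2 v)"]
    by (auto simp: if_distrib[of real_of_int])
  ultimately show ?thesis by (simp cong: prod.cong)
qed

text \<open>Averaging over \<open>c2\<close> removes every term that contains a sign of
  \<open>c2\<close>; what remains is the event that both endpoints keep their first colour.\<close>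

lemma expectation_alg_A_edge_prod_eq:
  assumes "u < n" "v < n" "u \<noteq> v"
  shows "measure_pmf.expectation (alg_A n E (2 * a)) (edge_prod {u, v}) =
    measure_pmf.expectation (pmf_of_set (cuts {..<n}))
      (\<lambda>c. c u * c v * (keep_cdf a E c u * keep_cdf a E c v))"
proof -
  let ?V = "cuts {..<n}"
  have inner: "measure_pmf.expectation (pmf_of_set ?V \<bind> (\<lambda>c2.
      map_pmf (recolour n E c1 c2) (Pi_pmf {..<n} 0 (\<lambda>_. dlap a)))) (edge_prod {u, v}) =
      c1 u * c1 v * (keep_cdf a E c1 u * keep_cdf a E c1 v)" if c1: "c1 \<in> ?V" for c1
  proof -
    let ?p = "keep_cdf a E c1 u" and ?q = "keep_cdf a E c1 v"
    let ?x = "real_of_int (c1 u)" and ?y = "real_of_int (c1 v)"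
    have "measure_pmf.expectation (pmf_of_set ?V \<bind> (\<lambda>c2.
        map_pmf (recolour n E c1 c2) (Pi_pmf {..<n} 0 (\<lambda>_. dlap a)))) (edge_prod {u, v}) =
        (\<Sum>c2\<in>?V. (?p * ?x + (1 - ?p) * c2 u) * (?q * ?y + (1 - ?q) * c2 v) / card ?V)"
      using assms c1
      by (subst pmf_expectation_bind_pmf_of_set)
        (auto simp: expectation_recolour_edge_prod divide_inverse simp del: set_map_pmf
          intro!: sum.cong finite_set_map_recolour)
    \<comment> \<open>The grouping makes the second term odd in \<open>c2 v\<close> and the third
      odd in \<open>c2 u\<close>.\<close>
    also have "\<dots> = (\<Sum>c2\<in>?V. (?p * ?x) * (?q * ?y) + (?p * ?x) * (1 - ?q) * c2 v
        + (1 - ?p) * (?q * ?y + (1 - ?q) * c2 v) * c2 u) / card ?V"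
      by (simp only: sum_divide_distrib) (rule sum.cong[OF refl], simp add: algebra_simps)
    also have "\<dots> = ?p * ?x * (?q * ?y)"
    proof -
      have "(\<Sum>c2\<in>?V. (?p * ?x) * (1 - ?q) * c2 v) = 0"
        by (rule sum_cuts_odd[of v]) (use assms in auto)
      moreover have "(\<Sum>c2\<in>?V. (1 - ?p) * (?q * ?y + (1 - ?q) * c2 v) * c2 u) = 0"
        by (rule sum_cuts_odd[of u]) (use assms in auto)
      ultimately show ?thesis by (simp add: sum.distrib card_cuts)
    qed
    finally show ?thesis by simp
  qed
  have "measure_pmf.expectation (alg_A n E (2 * a)) (edge_prod {u, v}) =
      (\<Sum>c1\<in>?V. c1 u * c1 v * (keep_cdf a E c1 u * keep_cdf a E c1 v) /\<^sub>R card ?V)"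
    unfolding alg_A_eq
    by (subst pmf_expectation_bind_pmf_of_set)
      (auto simp: inner simp del: set_map_pmf intro!: sum.cong finite_set_map_recolour)
  then show ?thesis
    by (simp add: integral_pmf_of_set sum_distrib_left divide_inverse mult.commute)
qed

lemma card_nbhd_minus:
  assumes "finite {w. {w, u} \<in> E}" "{u, v} \<in> E"
  shows "card ({w. {w, u} \<in> E} - {v}) = deg E u - 1"
  using assms by (simp add: deg_def insert_commute)

lemma simple_graph_finite_nbhd:
  assumes "simple_graph n E"
  shows "{w. {w, u} \<in> E} \<subseteq> {..<n} - {u}"
  using assms by (fastforce simp: simple_graph_def doubleton_eq_iff)

text \<open>Separates the neighbour \<open>v\<close> from the rest. Since \<open>y\<close> has to
  match \<open>c\<close> only at the other neighbours of \<open>u\<close>, the signs outside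
  \<open>u\<close> and \<open>v\<close> can be averaged on their own.\<close>

lemma agree_split:
  assumes "finite {w. {w, u} \<in> E}" "{u, v} \<in> E" "\<And>w. {w, u} \<in> E \<Longrightarrow> w \<noteq> v \<Longrightarrow> y w = c w"
  shows "agree E c u = (if c u = c v then 1 else 0) + card {w\<in>{w. {w, u} \<in> E} - {v}. y w = c u}"
proof -
  let ?M = "{w\<in>{w. {w, u} \<in> E} - {v}. y w = c u}"
  have "{w. {w, u} \<in> E \<and> c w = c u} = (if c u = c v then insert v ?M else ?M)"
    using assms(2,3) by (auto simp: insert_commute) metis
  moreover have "finite ?M" using assms(1) by auto
  then have "card (insert v ?M) = Suc (card ?M)" by (rule card_insert_disjoint) simp
  ultimately show ?thesis by (cases "c u = c v") (simp_all add: agree_def)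
qed

text \<open>Once the colours of \<open>u\<close> and \<open>v\<close> are fixed, the two keep
  probabilities average independently. The two equal pairs contribute p_u p_v and the two unequal
  pairs - q_u q_v, each with weight 1/4.\<close>

lemma expectation_alg_A_edge_prod:
  assumes G: "simple_graph n E" "triangle_free E" and uv: "{u, v} \<in> E"
  shows "measure_pmf.expectation (alg_A n E (2 * a)) (edge_prod {u, v}) =
    (keep_prob a (deg E u) 1 * keep_prob a (deg E v) 1 - keep_prob a (deg E u) 0 * keep_prob a (deg E v) 0) / 2"
proof -
  have nb: "{w. {w, x} \<in> E} \<subseteq> {..<n} - {x}" for x using G(1) by (rule simple_graph_finite_nbhd)
  have bounds: "u < n" "v < n" "u \<noteq> v"
    using nb[of u] nb[of v] uv by (auto simp: insert_commute)
  have finN: "finite {w. {w, x} \<in> E}" for x using nb by (rule finite_subset) auto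
  let ?Nu = "{w. {w, u} \<in> E} - {v}" and ?Nv = "{w. {w, v} \<in> E} - {u}"
  let ?W = "{..<n} - {u, v}"
  have sub: "?Nu \<subseteq> ?W" "?Nv \<subseteq> ?W" using nb[of u] nb[of v] by auto
  \<comment> \<open>A common neighbour of \<open>u\<close> and \<open>v\<close> would close a
    triangle; this is the one use of triangle-freeness.\<close>
  have disj: "?Nu \<inter> ?Nv = {}"
    using G(2) uv by (auto simp: triangle_free_def)
  have card: "card ?Nu = deg E u - 1" "card ?Nv = deg E v - 1"
    using card_nbhd_minus[OF finN uv] card_nbhd_minus[OF finN, of v u] uv by (simp_all only: insert_commute)
  have key: "measure_pmf.expectation (Pi_pmf ?W 0 (\<lambda>_. pmf_of_set {-1, 1}))
      (\<lambda>y. let c = y(v := t, u := s) in c u * c v * (keep_cdf a E c u * keep_cdf a E c v)) =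
      s * t * (keep_prob a (deg E u) (if s = t then 1 else 0) * keep_prob a (deg E v) (if s = t then 1 else 0))"
    if st: "s \<in> {-1, 1}" "t \<in> {-1, 1 :: int}" for s t
  proof -
    let ?k = "if s = t then 1 else 0 :: nat"
    let ?g = "\<lambda>x i. dlap_cdf a (int (deg E x div 2) - int (?k + i))"
    have "(let c = y(v := t, u := s) in c u * c v * (keep_cdf a E c u * keep_cdf a E c v)) =
        s * t * (?g u (card {w\<in>?Nu. y w = s}) * ?g v (card {w\<in>?Nv. y w = t}))" for y
    proof -
      let ?c = "y(v := t, u := s)"
      have "agree E ?c u = (if ?c u = ?c v then 1 else 0) + card {w\<in>?Nu. y w = ?c u}"
        by (rule agree_split[OF finN uv]) (use nb[of u] in auto)
      then have "agree E ?c u = ?k + card {w\<in>?Nu. y w = s}"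
        using bounds by simp
      moreover have "agree E ?c v = (if ?c v = ?c u then 1 else 0) + card {w\<in>?Nv. y w = ?c v}"
        by (rule agree_split[OF finN]) (use nb[of v] uv in \<open>auto simp: insert_commute\<close>)
      then have "agree E ?c v = ?k + card {w\<in>?Nv. y w = t}"
        using bounds by (simp add: eq_commute)
      ultimately show ?thesis using bounds by (simp add: Let_def)
    qed
    then have "measure_pmf.expectation (Pi_pmf ?W 0 (\<lambda>_. pmf_of_set {-1, 1}))
        (\<lambda>y. let c = y(v := t, u := s) in c u * c v * (keep_cdf a E c u * keep_cdf a E c v)) =
        s * t * measure_pmf.expectation (Pi_pmf ?W 0 (\<lambda>_. pmf_of_set {-1, 1}))
        (\<lambda>y. ?g u (card {w\<in>?Nu. y w = s}) * ?g v (card {w\<in>?Nv. y w = t}))"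
      by simp
    also have "\<dots> = s * t * (keep_prob a (deg E u) ?k * keep_prob a (deg E v) ?k)"
      using st sub disj
      by (subst expectation_signs_card_times) (simp_all only: finite_Diff finite_lessThan card expectation_binomial_half keep_prob_def)
    finally show ?thesis by (simp only: of_int_mult)
  qed
  show ?thesis
    unfolding expectation_alg_A_edge_prod_eq[OF bounds]
    using bounds key[of "-1" "-1"] key[of "-1" 1] key[of 1 "-1"] key[of 1 1]
    by (subst expectation_cuts_two_vertices[of _ u v]) (simp_all add: Let_def)
qed

lemma expectation_val:
  assumes "simple_graph n H" "\<Union>H \<subseteq> V" "finite V" "set_pmf p \<subseteq> cuts V"
  shows "measure_pmf.expectation p (\<lambda>S. real (val H S)) =
    (\<Sum>e\<in>H. (1 - measure_pmf.expectation p (edge_prod e)) / 2)"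
proof -
  have fin: "finite (set_pmf p)" using assms(3,4) finite_subset by fastforce
  have "measure_pmf.expectation p (\<lambda>S. real (val H S)) =
      measure_pmf.expectation p (\<lambda>S. \<Sum>e\<in>H. (1 - edge_prod e S) / 2)"
  proof (rule integral_cong_AE)
    have "real (val H S) = (\<Sum>e\<in>H. (1 - edge_prod e S) / 2)" if "S \<in> set_pmf p" for S
      using that assms(2,4) by (intro val_eq_sum[OF assms(1)]) (auto simp: cuts_def)
    then show "AE S in p. real (val H S) = (\<Sum>e\<in>H. (1 - edge_prod e S) / 2)"
      by (simp add: AE_measure_pmf_iff)
  qed auto
  also have "\<dots> = (\<Sum>e\<in>H. (1 - measure_pmf.expectation p (edge_prod e)) / 2)"
    using fin by (subst Bochner_Integration.integral_sum) (auto simp: integrable_measure_pmf_finite)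
  finally show ?thesis .
qed

text \<open>This is q_v - p_v; for positive \<open>d\<close>, \<open>keep_prob_diff\<close> shows it
  to be the probability that the binomial count plus the noise equals
  \<open>d div 2\<close>.\<close>

definition center_prob :: "real \<Rightarrow> nat \<Rightarrow> real" where
  "center_prob a d = keep_prob a d 0 - keep_prob a d 1"

text \<open>Each edge exceeds 1/2 by a quarter of q_u q_v - p_u p_v, which is itself at least a
  quarter of the sum of \<open>center_prob\<close> over both endpoints; hence the 16.
  \<open>handshake\<close> collects these gains at the vertices.\<close>

lemma expectation_val_alg_A:
  assumes G: "simple_graph n E" "triangle_free E" and a: "0 < a" "a \<le> 1/6"
  shows "real (card E) / 2 + (\<Sum>v<n. real (deg E v) * center_prob a (deg E v)) / 16 \<le>
    measure_pmf.expectation (alg_A n E (2 * a)) (\<lambda>S. real (val E S))"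
proof -
  let ?h = "\<lambda>v. center_prob a (deg E v)"
  have edge: "1/2 + (\<Sum>v\<in>e. ?h v) / 16 \<le> (1 - measure_pmf.expectation (alg_A n E (2 * a)) (edge_prod e)) / 2"
    if "e \<in> E" for e
  proof -
    from G(1) that obtain u v where e: "e = {u, v}" "u \<noteq> v" by (elim simple_graph_edgeE)
    then have uv: "{u, v} \<in> E" using that by simp
    have "finite {w. {w, x} \<in> E}" for x
      using simple_graph_finite_nbhd[OF G(1)] by (rule finite_subset) auto
    moreover have "v \<in> {w. {w, u} \<in> E}" "u \<in> {w. {w, v} \<in> E}"
      using uv by (auto simp: insert_commute)
    ultimately have d: "0 < deg E u" "0 < deg E v"
      unfolding deg_def card_gt_0_iff by blast+
    let ?p = "\<lambda>x. keep_prob a (deg E x) 1" and ?q = "\<lambda>x. keep_prob a (deg E x) 0"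
    have nonneg: "0 \<le> ?h x" if "0 < deg E x" for x
    proof -
      have "0 \<le> a / 3 * exp (- a * sqrt (deg E x))" using a by simp
      then show ?thesis using keep_prob_diff_ge_exp[OF a(1) that a(2)] by (simp add: center_prob_def)
    qed
    have "1/2 \<le> ?q x + ?p x" if "0 < deg E x" for x
      using keep_prob_0_ge_half[OF a(1) that] keep_prob_nonneg[OF a(1) that, of 1] by linarith
    \<comment> \<open>With h = q - p, twice q_u q_v - p_u p_v equals h_u (q_v + p_v) + h_v (q_u +
      p_u), and both brackets are at least 1/2.\<close>
    then have "?h u * (1/2) \<le> ?h u * (?q v + ?p v)" "?h v * (1/2) \<le> ?h v * (?q u + ?p u)"
      using nonneg d by (intro mult_left_mono; blast)+
    then have "(?h u * (1/2) + ?h v * (1/2)) / 2 \<le> (?h u * (?q v + ?p v) + ?h v * (?q u + ?p u)) / 2"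
      by (intro divide_right_mono add_mono) auto
    also have "\<dots> = ?q u * ?q v - ?p u * ?p v"
      by (simp add: center_prob_def algebra_simps diff_divide_distrib)
    finally have "(?h u + ?h v) / 4 \<le> ?q u * ?q v - ?p u * ?p v"
      by (simp add: add_divide_distrib)
    then show ?thesis
      using e by (simp add: expectation_alg_A_edge_prod[OF G uv] add_divide_distrib diff_divide_distrib)
  qed
  have "real (card E) / 2 + (\<Sum>v<n. real (deg E v) * ?h v) / 16 = (\<Sum>e\<in>E. 1/2 + (\<Sum>v\<in>e. ?h v) / 16)"
    by (simp add: handshake[OF G(1), symmetric] sum.distrib sum_divide_distrib)
  also have "\<dots> \<le> (\<Sum>e\<in>E. (1 - measure_pmf.expectation (alg_A n E (2 * a)) (edge_prod e)) / 2)"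
    by (rule sum_mono) (rule edge)
  also have "\<dots> = measure_pmf.expectation (alg_A n E (2 * a)) (\<lambda>S. real (val E S))"
    by (rule expectation_val[OF G(1) simple_graph_Union[OF G(1)] finite_lessThan set_alg_A, symmetric])
  finally show ?thesis .
qed

section \<open>The exponential mechanism\<close>

text \<open>The relative entropy of the Gibbs distribution with respect to the uniform one, which is
  \<open>b\<close> times the Gibbs mean minus \<open>ln (Z / card X)\<close>, is non-negative;
  termwise this is \<open>exp y >= 1 + y\<close>.\<close>

lemma gibbs_mean_lower:
  fixes f :: "'a \<Rightarrow> real"
  assumes "finite X" "X \<noteq> {}" "0 < b"
  defines "Z \<equiv> (\<Sum>x\<in>X. exp (b * f x))"
  shows "ln (Z / card X) / b \<le> (\<Sum>x\<in>X. f x * (exp (b * f x) / Z))"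
proof -
  let ?w = "\<lambda>x. exp (b * f x) / Z" and ?N = "real (card X)"
  have N: "0 < ?N" using assms(1,2) by (simp add: card_gt_0_iff)
  have Z: "0 < Z" unfolding Z_def using assms(1,2) by (intro sum_pos) auto
  have sum_w: "(\<Sum>x\<in>X. ?w x) = 1" using Z by (simp add: sum_divide_distrib[symmetric] Z_def)
  have "(\<Sum>x\<in>X. ?w x * (ln (Z / ?N) - b * f x)) \<le> (\<Sum>x\<in>X. 1 / ?N - ?w x)"
  proof (rule sum_mono)
    fix x
    have "exp (ln (Z / ?N) - b * f x) = (Z / ?N) / exp (b * f x)"
      using Z N by (simp add: exp_diff)
    then have "ln (Z / ?N) - b * f x \<le> (Z / ?N) / exp (b * f x) - 1"
      using exp_ge_add_one_self[of "ln (Z / ?N) - b * f x"] by simp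
    then have "?w x * (ln (Z / ?N) - b * f x) \<le> ?w x * ((Z / ?N) / exp (b * f x) - 1)"
      using Z by (intro mult_left_mono) auto
    also have "\<dots> = 1 / ?N - ?w x" using Z N by (simp add: field_simps)
    finally show "?w x * (ln (Z / ?N) - b * f x) \<le> 1 / ?N - ?w x" .
  qed
  also have "\<dots> = 0" using N sum_w by (simp add: sum_subtractf)
  finally have "(\<Sum>x\<in>X. ?w x * ln (Z / ?N) - b * (f x * ?w x)) \<le> 0"
    by (simp add: algebra_simps)
  moreover have "(\<Sum>x\<in>X. ?w x * ln (Z / ?N) - b * (f x * ?w x)) =
      ln (Z / ?N) - b * (\<Sum>x\<in>X. f x * ?w x)"
    by (simp only: sum_subtractf sum_distrib_left[symmetric] sum_distrib_right[symmetric] sum_w mult_1)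
  ultimately have "ln (Z / ?N) \<le> b * (\<Sum>x\<in>X. f x * ?w x)" by linarith
  then show ?thesis using assms(3) by (simp add: pos_divide_le_eq mult.commute)
qed

text \<open>Jensen's inequality for \<open>exp\<close> bounds \<open>Z / card X\<close> below by
  \<open>exp (b * m)\<close>, where \<open>m\<close> is the uniform mean.\<close>

lemma gibbs_ge_uniform_mean:
  fixes f :: "'a \<Rightarrow> real"
  assumes "finite X" "X \<noteq> {}" "0 < b"
  shows "(\<Sum>x\<in>X. f x) / card X \<le> (\<Sum>x\<in>X. f x * (exp (b * f x) / (\<Sum>x\<in>X. exp (b * f x))))"
proof -
  let ?N = "real (card X)" and ?Z = "\<Sum>x\<in>X. exp (b * f x)" and ?m = "(\<Sum>x\<in>X. f x) / card X"
  have N: "0 < ?N" using assms(1,2) by (simp add: card_gt_0_iff)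
  have Z: "0 < ?Z" using assms(1,2) by (intro sum_pos) auto
  have "?N = (\<Sum>x\<in>X. 1 + (b * f x - b * ?m))"
    using N by (simp add: sum.distrib sum_subtractf sum_distrib_left[symmetric])
  also have "\<dots> \<le> (\<Sum>x\<in>X. exp (b * f x - b * ?m))"
    by (intro sum_mono exp_ge_add_one_self)
  also have "\<dots> = ?Z / exp (b * ?m)" by (simp add: exp_diff sum_divide_distrib)
  finally have "exp (b * ?m) \<le> ?Z / ?N" using N by (simp add: field_simps)
  then have "b * ?m \<le> ln (?Z / ?N)" using Z N by (subst ln_ge_iff) auto
  then have "?m \<le> ln (?Z / ?N) / b" using assms(3) by (simp add: pos_le_divide_eq mult.commute)
  then show ?thesis using gibbs_mean_lower[OF assms, of f] by linarith
qed

text \<open>The partition function is restricted to \<open>Y\<close>. The loss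
  \<open>ln K / b\<close> depends on the proportion of good points, so it stays small when there are
  many of them.\<close>

lemma gibbs_ge_max:
  fixes f :: "'a \<Rightarrow> real"
  assumes "finite X" "0 < b" "Y \<subseteq> X" "Y \<noteq> {}" "\<And>y. y \<in> Y \<Longrightarrow> M \<le> f y"
    and K: "real (card X) \<le> K * real (card Y)"
  shows "M - ln K / b \<le> (\<Sum>x\<in>X. f x * (exp (b * f x) / (\<Sum>x\<in>X. exp (b * f x))))"
proof -
  let ?Z = "\<Sum>x\<in>X. exp (b * f x)"
  have X: "X \<noteq> {}" and finY: "finite Y" using assms(1,3,4) finite_subset by auto
  have N: "0 < real (card X)" "0 < real (card Y)" using X finY assms(1,4) by (simp_all add: card_gt_0_iff)
  then have "0 < K" using K by (metis less_le_trans mult_nonpos_nonneg not_le of_nat_0_le_iff)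
  have "exp (b * M) / K = exp (b * M) * real (card Y) / (K * real (card Y))" using N by simp
  also have "\<dots> \<le> exp (b * M) * real (card Y) / real (card X)"
    using K N \<open>0 < K\<close> by (intro divide_left_mono) auto
  also have "\<dots> \<le> ?Z / real (card X)"
  proof (rule divide_right_mono)
    have "exp (b * M) * real (card Y) = (\<Sum>y\<in>Y. exp (b * M))" by simp
    also have "\<dots> \<le> (\<Sum>y\<in>Y. exp (b * f y))"
      using assms(2,5) by (intro sum_mono) simp
    also have "\<dots> \<le> ?Z" using assms(1,3) by (intro sum_mono2) auto
    finally show "exp (b * M) * real (card Y) \<le> ?Z" .
  qed simp
  finally have "ln (exp (b * M) / K) \<le> ln (?Z / card X)"
    using \<open>0 < K\<close> by (intro ln_mono) auto
  then have "b * M - ln K \<le> ln (?Z / card X)" using \<open>0 < K\<close> by (simp add: ln_div)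
  then have "(b * M - ln K) / b \<le> ln (?Z / card X) / b" using assms(2) by (intro divide_right_mono) auto
  then show ?thesis
    using gibbs_mean_lower[OF assms(1) X assms(2), of f] assms(2) by (simp add: diff_divide_distrib)
qed

lemma pmf_expmech:
  assumes "finite C"
  shows "pmf (expmech E eps C) S = (if S \<in> cuts C then
      exp (eps * real (val (induced_edges E C) S) / 6) /
      (\<Sum>T\<in>cuts C. exp (eps * real (val (induced_edges E C) T) / 6)) else 0)"
  unfolding expmech_def
proof (rule pmf_embed_pmf)
  let ?Z = "\<Sum>T\<in>cuts C. exp (eps * real (val (induced_edges E C) T) / 6)"
  let ?w = "\<lambda>S. exp (eps * real (val (induced_edges E C) S) / 6) / ?Z"
  have Z: "0 < ?Z" using assms by (intro sum_pos) auto
  show "0 \<le> (if S \<in> cuts C then ?w S else 0)" for S using Z by simp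
  have "(\<integral>\<^sup>+ S. ennreal (if S \<in> cuts C then ?w S else 0) \<partial>count_space UNIV) =
      (\<Sum>S\<in>cuts C. ennreal (if S \<in> cuts C then ?w S else 0))"
    using assms by (intro nn_integral_count_space') auto
  also have "\<dots> = ennreal (\<Sum>S\<in>cuts C. ?w S)"
    using Z by (subst sum_ennreal[symmetric]) auto
  also have "(\<Sum>S\<in>cuts C. ?w S) = 1" using Z by (simp add: sum_divide_distrib[symmetric])
  finally show "(\<integral>\<^sup>+ S. ennreal (if S \<in> cuts C then ?w S else 0) \<partial>count_space UNIV) = 1" by simp
qed

lemma set_expmech: "finite C \<Longrightarrow> set_pmf (expmech E eps C) \<subseteq> cuts C"
  by (auto simp: set_pmf_eq pmf_expmech split: if_splits)

lemma expectation_expmech: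
  fixes f :: "(nat \<Rightarrow> int) \<Rightarrow> real"
  assumes "finite C"
  shows "measure_pmf.expectation (expmech E eps C) f =
    (\<Sum>S\<in>cuts C. f S * (exp (eps / 6 * real (val (induced_edges E C) S)) /
      (\<Sum>T\<in>cuts C. exp (eps / 6 * real (val (induced_edges E C) T)))))"
  using set_expmech[OF assms] assms
  by (subst integral_measure_pmf_real[of "cuts C"]) (auto simp: pmf_expmech)

lemma val_cong:
  assumes "\<And>e v. e \<in> H \<Longrightarrow> v \<in> e \<Longrightarrow> S v = T v"
  shows "val H S = val H T"
  unfolding val_def
proof (intro arg_cong[of _ _ card] Collect_cong conj_cong ex_cong1 refl)
  fix e u v assume "e \<in> H" "e = {u, v}"
  then have "S u = T u" "S v = T v" using assms by auto
  then show "(S u \<noteq> S v) = (T u \<noteq> T v)" by simp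
qed

lemma deg_pos:
  assumes "simple_graph n E" "e \<in> E" "v \<in> e"
  shows "0 < deg E v"
proof -
  from assms(1,2) obtain a b where "e = {a, b}" by (elim simple_graph_edgeE)
  with assms(3) have "e = {b, v} \<or> e = {a, v}" by auto
  then obtain u where "e = {u, v}" by blast
  moreover have "finite {w. {w, v} \<in> E}"
    using simple_graph_finite_nbhd[OF assms(1)] by (rule finite_subset) auto
  ultimately show ?thesis using assms(2) unfolding deg_def card_gt_0_iff by blast
qed

text \<open>Changing \<open>T\<close> on isolated vertices keeps its value, so cuts as good as
  \<open>T\<close> make up at least a fraction \<open>1 / 2 ^ k\<close> of all cuts,
  \<open>k\<close> being the number of non-isolated vertices of \<open>C\<close>. The loss must
  avoid isolated vertices, at which the recolouring gains nothing.\<close>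

lemma expectation_val_expmech_ge_cut:
  assumes G: "simple_graph n E" and C: "finite C" and eps: "0 < eps" and T: "T \<in> cuts C"
  shows "real (val (induced_edges E C) T) - 6 / eps * card {v\<in>C. 0 < deg E v} \<le>
    measure_pmf.expectation (expmech E eps C) (\<lambda>S. real (val (induced_edges E C) S))"
proof -
  let ?H = "induced_edges E C" and ?P = "{v\<in>C. 0 < deg E v}" and ?I = "{v\<in>C. deg E v = 0}"
  let ?Y = "{S\<in>cuts C. val ?H S = val ?H T}"
  have "card (cuts ?I) \<le> card ?Y"
  proof (rule card_inj_on_le[of "\<lambda>R v. if v \<in> ?I then R v else T v"])
    show "inj_on (\<lambda>R v. if v \<in> ?I then R v else T v) (cuts ?I)"
    proof (rule inj_onI, rule ext)
      fix R R' v
      assume R: "R \<in> cuts ?I" "R' \<in> cuts ?I"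
        and eq: "(\<lambda>v. if v \<in> ?I then R v else T v) = (\<lambda>v. if v \<in> ?I then R' v else T v)"
      show "R v = R' v"
        using R fun_cong[OF eq, of v] by (cases "v \<in> ?I") (auto simp: cuts_def)
    qed
    show "(\<lambda>R v. if v \<in> ?I then R v else T v) ` cuts ?I \<subseteq> ?Y"
    proof (intro image_subsetI CollectI conjI)
      fix R assume "R \<in> cuts ?I"
      then show "(\<lambda>v. if v \<in> ?I then R v else T v) \<in> cuts C" using T by (auto simp: cuts_def)
      show "val ?H (\<lambda>v. if v \<in> ?I then R v else T v) = val ?H T"
      proof (rule val_cong)
        fix e v assume "e \<in> ?H" "v \<in> e"
        then have "0 < deg E v" by (intro deg_pos[OF G]) (auto simp: induced_edges_def)
        then show "(if v \<in> ?I then R v else T v) = T v" by simp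
      qed
    qed
  qed (use C in simp)
  moreover have "card C = card ?P + card ?I"
  proof -
    have "C = ?P \<union> ?I" by auto
    then have "card C = card (?P \<union> ?I)" by (rule arg_cong)
    also have "\<dots> = card ?P + card ?I" using C by (intro card_Un_disjoint) auto
    finally show ?thesis .
  qed
  ultimately have "card (cuts C) \<le> 2 ^ card ?P * card ?Y"
    using C by (simp add: card_cuts power_add)
  then have "real (card (cuts C)) \<le> real (2 ^ card ?P * card ?Y)" by (rule of_nat_mono)
  then have "real (card (cuts C)) \<le> 2 ^ card ?P * real (card ?Y)" by simp
  then have "real (val ?H T) - ln (2 ^ card ?P) / (eps / 6) \<le>
      measure_pmf.expectation (expmech E eps C) (\<lambda>S. real (val ?H S))"
    unfolding expectation_expmech[OF C] using C T eps
    by (intro gibbs_ge_max[of _ _ ?Y]) auto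
  moreover have "ln (2 ^ card ?P) / (eps / 6) \<le> 6 / eps * card ?P"
  proof -
    have "ln (2 ^ card ?P) / (eps / 6) = 6 / eps * (card ?P * ln 2)" by (simp add: ln_realpow)
    moreover have "ln (2::real) \<le> 1" using ln_2_less_1 by simp
    then have "real (card ?P) * ln 2 \<le> real (card ?P) * 1" by (intro mult_left_mono) auto
    then have "6 / eps * (card ?P * ln 2) \<le> 6 / eps * (card ?P * 1)"
      using eps by (intro mult_left_mono) auto
    ultimately show ?thesis by (simp only:)
  qed
  ultimately show ?thesis by linarith
qed

text \<open>A uniform cut separates each edge with probability 1/2, and the Gibbs mean is at least
  the uniform mean.\<close>

lemma expectation_val_expmech_ge_half:
  assumes G: "simple_graph n E" and C: "finite C" and eps: "0 < eps"
  shows "real (card (induced_edges E C)) / 2 \<le>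
    measure_pmf.expectation (expmech E eps C) (\<lambda>S. real (val (induced_edges E C) S))"
proof -
  let ?H = "induced_edges E C"
  have H: "simple_graph n ?H" using G by (rule simple_graph_subset) (auto simp: induced_edges_def)
  have sub: "e \<subseteq> C" if "e \<in> ?H" for e using that by (auto simp: induced_edges_def)
  have "(\<Sum>S\<in>cuts C. real (val ?H S)) = (\<Sum>S\<in>cuts C. \<Sum>e\<in>?H. (1 - edge_prod e S) / 2)"
    using sub by (intro sum.cong[OF refl] val_eq_sum[OF H]) (auto simp: cuts_def)
  also have "\<dots> = (\<Sum>e\<in>?H. \<Sum>S\<in>cuts C. (1 - edge_prod e S) / 2)" by (rule sum.swap)
  also have "\<dots> = (\<Sum>e\<in>?H. card (cuts C) / 2)"
  proof (rule sum.cong[OF refl])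
    fix e assume e: "e \<in> ?H"
    from H e obtain u v where uv: "e = {u, v}" by (elim simple_graph_edgeE)
    have "(\<Sum>S\<in>cuts C. edge_prod e S) = 0"
      by (rule sum_cuts_odd[of u]) (use sub[OF e] uv in \<open>auto intro!: edge_prod_fun_upd\<close>)
    then show "(\<Sum>S\<in>cuts C. (1 - edge_prod e S) / 2) = card (cuts C) / 2"
      by (simp add: sum_divide_distrib[symmetric] sum_subtractf)
  qed
  finally have avg: "(\<Sum>S\<in>cuts C. real (val ?H S)) / card (cuts C) = real (card ?H) / 2"
    using C by (simp add: card_cuts)
  have "0 < eps / 6" using eps by simp
  from gibbs_ge_uniform_mean[OF finite_cuts[OF C] cuts_nonempty this, of "\<lambda>S. real (val ?H S)"]
  show ?thesis unfolding expectation_expmech[OF C] avg .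
qed

section \<open>The concatenated cut\<close>

lemma set_S1_pmf:
  assumes "C \<subseteq> {..<n}"
  shows "set_pmf (S1_pmf n E eps C) \<subseteq> cuts {..<n}"
proof -
  have C: "finite C" using assms finite_subset by blast
  have "(\<lambda>v. if v \<in> C then SA v else SB v) \<in> cuts {..<n}"
    if "SA \<in> cuts C" "SB \<in> cuts ({..<n} - C)" for SA SB
    using that assms by (auto simp: cuts_def)
  then show ?thesis
    using set_expmech[OF C] by (auto simp: S1_pmf_def set_bind_pmf) (meson subsetD)+
qed

text \<open>An edge not inside \<open>C\<close> has an endpoint whose sign in \<open>SB\<close> is
  uniform and independent of the rest, so its product averages to 0.\<close>

lemma expectation_S1_edge_prod:
  assumes G: "simple_graph n E" and C: "C \<subseteq> {..<n}" and e: "e \<in> E"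
  shows "measure_pmf.expectation (S1_pmf n E eps C) (edge_prod e) =
    (if e \<subseteq> C then measure_pmf.expectation (expmech E eps C) (edge_prod e) else 0)"
proof -
  have finC: "finite C" using C finite_subset by blast
  let ?B = "{..<n} - C"
  let ?h = "\<lambda>SA SB v. if v \<in> C then SA v else SB v :: int"
  have fin_e: "finite e" "e \<subseteq> {..<n}" using G e by (auto elim!: simple_graph_edgeE)
  have inner: "measure_pmf.expectation (pmf_of_set (cuts ?B) \<bind> (\<lambda>SB. return_pmf (?h SA SB))) (edge_prod e) =
      (if e \<subseteq> C then edge_prod e SA else 0)" for SA
  proof -
    have "measure_pmf.expectation (pmf_of_set (cuts ?B) \<bind> (\<lambda>SB. return_pmf (?h SA SB))) (edge_prod e) =
        (\<Sum>SB\<in>cuts ?B. edge_prod e (?h SA SB)) / card (cuts ?B)"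
      by (subst pmf_expectation_bind_pmf_of_set) (auto simp: sum_divide_distrib divide_inverse sum_distrib_left mult.commute)
    also have "\<dots> = (if e \<subseteq> C then edge_prod e SA else 0)"
    proof (cases "e \<subseteq> C")
      case True
      then have "edge_prod e (?h SA SB) = edge_prod e SA" for SB
        unfolding edge_prod_def by (intro prod.cong) auto
      then show ?thesis using True by (simp add: card_cuts)
    next
      case False
      then obtain w where w: "w \<in> e" "w \<notin> C" by auto
      have upd: "?h SA (SB(w := - SB w)) = (?h SA SB)(w := - ?h SA SB w)" for SB
        using w by auto
      have odd: "edge_prod e (?h SA (SB(w := - SB w))) = - edge_prod e (?h SA SB)" for SB
        unfolding upd by (rule edge_prod_fun_upd[OF fin_e(1) w(1), of "?h SA SB"])
      have "(\<Sum>SB\<in>cuts ?B. edge_prod e (?h SA SB)) = 0"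
        by (rule sum_cuts_odd[of w]) (use w fin_e in blast, rule odd)
      then show ?thesis using False by simp
    qed
    finally show ?thesis .
  qed
  have "measure_pmf.expectation (S1_pmf n E eps C) (edge_prod e) =
      (\<Sum>SA\<in>cuts C. pmf (expmech E eps C) SA * (if e \<subseteq> C then edge_prod e SA else 0))"
    unfolding S1_pmf_def using finC set_expmech[OF finC]
    by (subst pmf_expectation_bind[of "cuts C"]) (auto simp: inner set_bind_pmf)
  also have "\<dots> = (if e \<subseteq> C then measure_pmf.expectation (expmech E eps C) (edge_prod e) else 0)"
    using finC set_expmech[OF finC] by (subst integral_measure_pmf_real[of "cuts C"]) (auto simp: mult.commute)
  finally show ?thesis .
qed

lemma expectation_val_S1:
  assumes G: "simple_graph n E" and C: "C \<subseteq> {..<n}"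
  shows "measure_pmf.expectation (S1_pmf n E eps C) (\<lambda>S. real (val E S)) =
    measure_pmf.expectation (expmech E eps C) (\<lambda>S. real (val (induced_edges E C) S)) +
    (real (card E) - real (card (induced_edges E C))) / 2"
proof -
  let ?H = "induced_edges E C"
  have finC: "finite C" using C finite_subset by blast
  have finE: "finite E" using G by (rule simple_graph_finite)
  have HE: "?H \<subseteq> E" by (auto simp: induced_edges_def)
  have "measure_pmf.expectation (S1_pmf n E eps C) (\<lambda>S. real (val E S)) =
      (\<Sum>e\<in>E. (1 - measure_pmf.expectation (S1_pmf n E eps C) (edge_prod e)) / 2)"
    by (rule expectation_val[OF G simple_graph_Union[OF G] finite_lessThan set_S1_pmf[OF C]])
  also have "\<dots> = (\<Sum>e\<in>E. 1/2 - (if e \<in> ?H then measure_pmf.expectation (expmech E eps C) (edge_prod e) / 2 else 0))"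
    by (rule sum.cong) (auto simp: expectation_S1_edge_prod[OF G C] induced_edges_def diff_divide_distrib)
  also have "\<dots> = real (card E) / 2 - (\<Sum>e\<in>?H. measure_pmf.expectation (expmech E eps C) (edge_prod e) / 2)"
    using finE HE by (simp add: sum_subtractf sum.If_cases Int_absorb1)
  also have "(\<Sum>e\<in>?H. measure_pmf.expectation (expmech E eps C) (edge_prod e) / 2) =
      real (card ?H) / 2 - measure_pmf.expectation (expmech E eps C) (\<lambda>S. real (val ?H S))"
  proof -
    have "simple_graph n ?H" using G HE by (rule simple_graph_subset)
    then have "measure_pmf.expectation (expmech E eps C) (\<lambda>S. real (val ?H S)) =
        (\<Sum>e\<in>?H. (1 - measure_pmf.expectation (expmech E eps C) (edge_prod e)) / 2)"
      by (rule expectation_val[OF _ _ finC set_expmech[OF finC]]) (auto simp: induced_edges_def)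
    then show ?thesis by (simp add: diff_divide_distrib sum_subtractf)
  qed
  finally show ?thesis by (simp add: diff_divide_distrib)
qed

lemma OPT_attained: "\<exists>T\<in>cuts {..<n}. val E T = OPT n E"
proof -
  have "OPT n E \<in> val E ` cuts {..<n}" unfolding OPT_def by (rule Max_in) auto
  then show ?thesis by auto
qed

text \<open>A convex combination of two bounds for the exponential mechanism: weight
  \<open>l\<close> on the one from an optimal cut, \<open>1 - l\<close> on \<open>m1 / 2\<close>.
  Restricting an optimal cut to \<open>C\<close> loses at most the \<open>m - m1\<close> edges that
  are not induced.\<close>

lemma expectation_val_S1_ge:
  assumes G: "simple_graph n E" and C: "C \<subseteq> {..<n}" and eps: "0 < eps" and l: "0 \<le> l" "l \<le> 1"
  defines "m \<equiv> real (card E)" and "m1 \<equiv> real (card (induced_edges E C))"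
  shows "m / 2 + l * (real (OPT n E) - (m - m1) - m1 / 2 - 6 / eps * card {v\<in>C. 0 < deg E v}) \<le>
    measure_pmf.expectation (S1_pmf n E eps C) (\<lambda>S. real (val E S))"
proof -
  let ?H = "induced_edges E C" and ?X = "measure_pmf.expectation (expmech E eps C) (\<lambda>S. real (val (induced_edges E C) S))"
  let ?L = "6 / eps * card {v\<in>C. 0 < deg E v}"
  have finC: "finite C" using C finite_subset by blast
  have finE: "finite E" using G by (rule simple_graph_finite)
  obtain T where T: "T \<in> cuts {..<n}" "val E T = OPT n E" using OPT_attained by blast
  \<comment> \<open>Membership in \<open>cuts C\<close> demands the default value 0 outside
    \<open>C\<close>.\<close>
  let ?T = "\<lambda>v. if v \<in> C then T v else 0"
  have "?T \<in> cuts C" using T(1) C by (auto simp: cuts_def)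
  then have X1: "real (val ?H ?T) - ?L \<le> ?X"
    by (rule expectation_val_expmech_ge_cut[OF G finC eps])
  have X2: "m1 / 2 \<le> ?X"
    unfolding m1_def by (rule expectation_val_expmech_ge_half[OF G finC eps])
  have "val E T \<le> val ?H T + card (E - ?H)"
  proof -
    have "val E T \<le> card ({e\<in>?H. \<exists>u v. e = {u, v} \<and> T u \<noteq> T v} \<union> (E - ?H))"
      unfolding val_def using finE by (intro card_mono) (auto simp: induced_edges_def)
    also have "\<dots> \<le> val ?H T + card (E - ?H)" unfolding val_def by (rule card_Un_le)
    finally show ?thesis .
  qed
  moreover have "val ?H T = val ?H ?T" by (rule val_cong) (auto simp: induced_edges_def)
  moreover have "card (E - ?H) = card E - card ?H" "card ?H \<le> card E"
    using finE by (auto simp: induced_edges_def intro!: card_Diff_subset card_mono)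
  ultimately have "real (OPT n E) \<le> real (val ?H ?T) + (m - m1)"
    unfolding m_def m1_def using T(2) by linarith
  then have "real (OPT n E) - (m - m1) - ?L \<le> ?X" using X1 by linarith
  then have "l * (real (OPT n E) - (m - m1) - ?L) + (1 - l) * (m1 / 2) \<le> l * ?X + (1 - l) * ?X"
    using X2 l by (intro add_mono mult_left_mono) auto
  then have "l * (real (OPT n E) - (m - m1) - m1 / 2 - ?L) + m1 / 2 \<le> ?X"
    by (simp add: algebra_simps diff_divide_distrib)
  then show ?thesis
    unfolding expectation_val_S1[OF G C] m_def[symmetric] m1_def[symmetric] by (simp add: diff_divide_distrib)
qed

section \<open>Laplace noise and the trade-off at a vertex\<close>

text \<open>The cases \<open>k = 0\<close> and \<open>k = 1\<close> yield the total mass and the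
  first absolute moment of the Laplace distribution.\<close>

lemma nn_integral_abs_power_exp:
  "(\<integral>\<^sup>+ x. ennreal (\<bar>x\<bar> ^ k * exp (- \<bar>x\<bar>)) \<partial>lborel) = ennreal (2 * fact k)"
proof -
  let ?f = "\<lambda>x::real. ennreal (x ^ k * exp (- x)) * indicator {0..} x"
  have "(\<integral>\<^sup>+ x. ennreal (\<bar>x\<bar> ^ k * exp (- \<bar>x\<bar>)) \<partial>lborel) = (\<integral>\<^sup>+ x. ?f x + ?f (- x) \<partial>lborel)"
  proof (rule nn_integral_cong_AE)
    \<comment> \<open>Both half-lines contain 0, so for \<open>k = 0\<close> the identity fails at
      this single null point.\<close>
    show "AE x in lborel. ennreal (\<bar>x\<bar> ^ k * exp (- \<bar>x\<bar>)) = ?f x + ?f (- x)"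
      using AE_lborel_singleton[of "0::real"] by eventually_elim (auto split: split_indicator)
  qed
  also have "\<dots> = (\<integral>\<^sup>+ x. ?f x \<partial>lborel) + (\<integral>\<^sup>+ x. ?f (- x) \<partial>lborel)"
    by (rule nn_integral_add) auto
  also have "(\<integral>\<^sup>+ x. ?f (- x) \<partial>lborel) = (\<integral>\<^sup>+ x. ?f x \<partial>lborel)"
    using nn_integral_real_affine[of ?f "-1" 0] by simp
  also have "(\<integral>\<^sup>+ x. ?f x \<partial>lborel) = ennreal (fact k)"
    by (subst nn_intergal_power_times_exp_Ici) simp
  also have "ennreal (fact k) + ennreal (fact k) = ennreal (fact k + fact k)"
    by (rule ennreal_plus[symmetric]) auto
  finally show ?thesis by (simp only: mult_2)
qed

lemma sets_lap [simp, measurable_cong]: "sets (lap b) = sets borel"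
  by (simp add: lap_def)

lemma space_lap [simp]: "space (lap b) = UNIV"
  by (simp add: lap_def)

lemma nn_integral_lap_abs_power:
  assumes "0 < b"
  shows "(\<integral>\<^sup>+ x. ennreal (\<bar>x\<bar> ^ k) \<partial>lap b) = ennreal (b ^ k * fact k)"
proof -
  have "(\<integral>\<^sup>+ x. ennreal (\<bar>x\<bar> ^ k) \<partial>lap b) =
      (\<integral>\<^sup>+ x. ennreal (exp (- \<bar>x\<bar> / b) / (2 * b)) * ennreal (\<bar>x\<bar> ^ k) \<partial>lborel)"
    unfolding lap_def by (subst nn_integral_density) auto
  also have "\<dots> = ennreal b * (\<integral>\<^sup>+ x. ennreal (exp (- \<bar>b * x\<bar> / b) / (2 * b)) * ennreal (\<bar>b * x\<bar> ^ k) \<partial>lborel)"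
    using assms by (subst nn_integral_real_affine[where c = b and t = 0]) auto
  also have "(\<integral>\<^sup>+ x. ennreal (exp (- \<bar>b * x\<bar> / b) / (2 * b)) * ennreal (\<bar>b * x\<bar> ^ k) \<partial>lborel) =
      (\<integral>\<^sup>+ x. ennreal (b ^ k / (2 * b)) * ennreal (\<bar>x\<bar> ^ k * exp (- \<bar>x\<bar>)) \<partial>lborel)"
    using assms by (intro nn_integral_cong)
      (simp add: ennreal_mult[symmetric] abs_mult power_mult_distrib mult_ac)
  also have "\<dots> = ennreal (b ^ k / (2 * b)) * ennreal (2 * fact k)"
    by (subst nn_integral_cmult) (auto simp: nn_integral_abs_power_exp)
  also have "ennreal b * (ennreal (b ^ k / (2 * b)) * ennreal (2 * fact k)) = ennreal (b ^ k * fact k)"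
    using assms by (simp add: ennreal_mult[symmetric] field_simps)
  finally show ?thesis .
qed

lemma prob_space_lap:
  assumes "0 < b"
  shows "prob_space (lap b)"
proof
  show "emeasure (lap b) (space (lap b)) = 1"
    using nn_integral_lap_abs_power[OF assms, of 0] by simp
qed

text \<open>Markov's inequality; the mean of the absolute value is \<open>b\<close>.\<close>

lemma lap_tail:
  assumes "0 < b" "0 < t"
  shows "measure (lap b) {x. t \<le> \<bar>x\<bar>} \<le> b / t"
proof -
  interpret prob_space "lap b" using assms(1) by (rule prob_space_lap)
  have "(1 \<le> ennreal (1 / t) * ennreal \<bar>x\<bar>) = (t \<le> \<bar>x\<bar>)" for x
  proof -
    have "ennreal (1 / t) * ennreal \<bar>x\<bar> = ennreal (\<bar>x\<bar> / t)"
      using assms(2) by (simp add: ennreal_mult[symmetric])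
    then show ?thesis using assms(2) by (simp add: ennreal_ge_1)
  qed
  then have "emeasure (lap b) {x. t \<le> \<bar>x\<bar>} = emeasure (lap b) {x\<in>UNIV. 1 \<le> ennreal (1 / t) * ennreal \<bar>x\<bar>}"
    by simp
  also have "\<dots> \<le> ennreal (1 / t) * (\<integral>\<^sup>+ x. ennreal \<bar>x\<bar> * indicator UNIV x \<partial>lap b)"
    by (rule nn_integral_Markov_inequality) auto
  also have "\<dots> = ennreal (b / t)"
    using nn_integral_lap_abs_power[OF assms(1), of 1] assms by (simp add: ennreal_mult[symmetric])
  finally show ?thesis
    using assms by (simp add: emeasure_eq_measure)
qed

text \<open>
  Here \<open>pin\<close> and \<open>pout\<close> are the probabilities that the vertex lies inside or outside
  $\mathcal C$, and the exponent 24 comes from $\sqrt{20000}/6 < 24$.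
\<close>

lemma vertex_tradeoff:
  fixes eps pin pout :: real and d :: nat
  assumes eps: "0 < eps" "eps \<le> 1" and d: "0 < d"
    and pin: "0 \<le> pin" "pin \<le> 1" "real d < 5000 / eps\<^sup>2 \<Longrightarrow> pin \<le> eps"
    and pout: "0 \<le> pout" "pout \<le> 1" "20000 / eps\<^sup>2 < real d \<Longrightarrow> pout \<le> 6 / (eps * d)"
  shows "exp (- 24) / 10000 * (eps * d * pout + 12 * pin) \<le> real d * center_prob (eps / 6) d / 32"
proof -
  have a: "0 < eps / 6" "eps / 6 \<le> 1/6" using eps by auto
  let ?r = "center_prob (eps / 6) d"
  show ?thesis
  \<comment> \<open>The split is at twice the cutoff \<open>10000 / eps^2\<close>. Up to there the
    gain is of order \<open>eps * d\<close>; beyond it the gain is at least a constant and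
    \<open>pout\<close> is small.\<close>
  proof (cases "real d \<le> 20000 / eps\<^sup>2")
    case True
    \<comment> \<open>\<open>142 ^ 2 = 20164\<close> exceeds 20000, and
      \<open>142 / 6 < 24\<close>.\<close>
    have "sqrt d \<le> 142 / eps"
    proof (rule real_le_lsqrt)
      show "real d \<le> (142 / eps)\<^sup>2"
      proof -
        have "20000 / eps\<^sup>2 \<le> (142 / eps)\<^sup>2"
          unfolding power_divide by (rule divide_right_mono) auto
        then show ?thesis using True by linarith
      qed
    qed (use eps in auto)
    then have "eps / 6 * sqrt d \<le> eps / 6 * (142 / eps)" using a by (intro mult_left_mono) auto
    also have "\<dots> \<le> 24" using eps by simp
    finally have "exp (- 24) \<le> exp (- (eps / 6) * sqrt d)" by simp
    then have "eps / 6 / 3 * exp (- 24) \<le> eps / 6 / 3 * exp (- (eps / 6) * sqrt d)"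
      using eps by (intro mult_left_mono) auto
    then have r: "eps / 18 * exp (- 24) \<le> ?r"
      using keep_prob_diff_ge_exp[OF a(1) d a(2)] by (simp add: center_prob_def)
    \<comment> \<open>Below half the cutoff \<open>pin\<close> is at most \<open>eps\<close>; from
      there on \<open>eps * d\<close> is at least 1.\<close>
    have "pin \<le> eps * d"
    proof (cases "real d < 5000 / eps\<^sup>2")
      case True
      have "eps * 1 \<le> eps * d" using eps d by (intro mult_left_mono) auto
      then show ?thesis using pin(3)[OF True] by simp
    next
      case False
      have "1 \<le> 5000 / eps" using eps by simp
      also have "\<dots> = eps * (5000 / eps\<^sup>2)" using eps by (simp add: power2_eq_square)
      also have "\<dots> \<le> eps * d" using False eps by (intro mult_left_mono) auto
      finally show ?thesis using pin(2) by simp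
    qed
    moreover have "eps * d * pout \<le> eps * d * 1" using eps pout by (intro mult_left_mono) auto
    ultimately have "eps * d * pout + 12 * pin \<le> 13 * (eps * d)" by linarith
    then have "exp (- 24) / 10000 * (eps * d * pout + 12 * pin) \<le> exp (- 24) / 10000 * (13 * (eps * d))"
      by (intro mult_left_mono) auto
    also have "\<dots> = 13 / 10000 * (d * (eps * exp (- 24)))" by simp
    \<comment> \<open>\<open>576 = 18 * 32\<close> joins the 18 of the bound on \<open>?r\<close>
      with the 32 of the goal.\<close>
    also have "\<dots> \<le> 1 / 576 * (d * (eps * exp (- 24)))" using eps by (intro mult_right_mono) auto
    also have "\<dots> = d * (eps / 18 * exp (- 24)) / 32" by simp
    also have "\<dots> \<le> d * ?r / 32" using r by (intro divide_right_mono mult_left_mono) auto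
    finally show ?thesis .
  next
    case False
    \<comment> \<open>Then \<open>d * ?r\<close> is at least \<open>eps * sqrt d / 36\<close>, hence
      at least 1, while the bracketed cost is at most \<open>6 + 12\<close>.\<close>
    have "100 / eps \<le> sqrt d"
    proof (rule real_le_rsqrt)
      have "(100 / eps)\<^sup>2 \<le> 20000 / eps\<^sup>2"
        unfolding power_divide by (rule divide_right_mono) auto
      then show "(100 / eps)\<^sup>2 \<le> real d" using False by linarith
    qed
    then have "eps * (100 / eps) \<le> eps * sqrt d" using eps by (intro mult_left_mono) auto
    then have s: "100 \<le> eps * sqrt d" using eps by simp
    have "d * (eps / 6 / 3 * (1 / (2 * sqrt d))) = eps / 36 * (d / sqrt d)" by simp
    also have "\<dots> = eps * sqrt d / 36" by (simp only: real_div_sqrt[OF of_nat_0_le_iff])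
    finally have "1 \<le> d * (eps / 6 / 3 * (1 / (2 * sqrt d)))" using s by linarith
    also have "\<dots> \<le> d * ?r"
      using keep_prob_diff_ge_sqrt[OF a(1) d a(2)] by (intro mult_left_mono) (auto simp: center_prob_def)
    finally have r: "1 \<le> d * ?r" .
    have "eps * d * pout \<le> eps * d * (6 / (eps * d))"
      using pout(3) False eps by (intro mult_left_mono) auto
    also have "\<dots> = 6" using eps d by simp
    finally have "eps * d * pout + 12 * pin \<le> 18" using pin by linarith
    then have "exp (- 24) / 10000 * (eps * d * pout + 12 * pin) \<le> exp (- 24) / 10000 * 18"
      by (intro mult_left_mono) auto
    also have "\<dots> \<le> 1 / 10000 * 18" by (intro mult_right_mono divide_right_mono) auto
    also have "\<dots> \<le> d * ?r / 32" using r by simp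
    finally show ?thesis .
  qed
qed

section \<open>Combining the two cuts for a fixed vertex set\<close>

text \<open>Each edge that is not induced is charged to an endpoint outside
  \<open>C\<close>.\<close>

lemma card_uninduced_le:
  assumes G: "simple_graph n E"
  shows "real (card E) - real (card (induced_edges E C)) \<le> (\<Sum>v<n. real (deg E v) * (if v \<in> C then 0 else 1))"
proof -
  have finE: "finite E" using G by (rule simple_graph_finite)
  have "real (card E) - real (card (induced_edges E C)) = (\<Sum>e\<in>E. if e \<subseteq> C then 0 else 1)"
  proof -
    have "real (card E) = (\<Sum>e\<in>E. (if e \<subseteq> C then 1 else 0) + (if e \<subseteq> C then 0 else 1))"
      by (simp add: if_distrib cong: if_cong)
    also have "\<dots> = real (card (induced_edges E C)) + (\<Sum>e\<in>E. if e \<subseteq> C then 0 else 1)"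
      using finE by (simp only: sum.distrib) (simp add: induced_edges_def sum.If_cases Int_def)
    finally show ?thesis by simp
  qed
  also have "\<dots> \<le> (\<Sum>e\<in>E. \<Sum>v\<in>e. if v \<in> C then 0 else 1)"
  proof (rule sum_mono)
    fix e assume "e \<in> E"
    then have fin: "finite e" using G by (auto elim: simple_graph_edgeE)
    show "(if e \<subseteq> C then 0 else 1) \<le> (\<Sum>v\<in>e. if v \<in> C then 0 else 1 :: real)"
    proof (cases "e \<subseteq> C")
      case False
      then obtain w where "w \<in> e" "w \<notin> C" by auto
      then show ?thesis using member_le_sum[of w e "\<lambda>v. if v \<in> C then 0 else 1 :: real"] fin False by simp
    qed (simp add: sum_nonneg)
  qed
  also have "\<dots> = (\<Sum>v<n. real (deg E v) * (if v \<in> C then 0 else 1))"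
    by (rule handshake[OF G])
  finally show ?thesis .
qed

text \<open>Here \<open>x\<close> stands for the optimum and \<open>k\<close> for
  \<open>c * eps\<close>. The coin halves the weight \<open>4 * k\<close> to \<open>2 * k\<close>:
  one copy of \<open>k * (x - m)\<close> added to \<open>m / 2\<close> still leaves
  \<open>x / 2\<close> by \<open>slack\<close>, the other leaves the gain \<open>k * x\<close> and
  the loss \<open>k * (m - m1)\<close>, which \<open>D\<close> bounds.\<close>

lemma combine_bounds:
  fixes g k m m1 p q x A D S T :: real
  assumes A: "m / 2 + g / 16 \<le> A"
    and S: "m / 2 + 4 * k * (x - (m - m1) - m1 / 2 - p) \<le> S"
    and slack: "0 \<le> (m - x) * (1/2 - k)" and D: "k * (m - m1) \<le> k * D" and p: "k * p = 6 * q"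
    and T: "T = k * D + 12 * q"
  shows "(1/2 + k) * x + g / 32 - T \<le> S / 2 + A / 2"
proof -
  \<comment> \<open>The products are replaced by variables, which makes the claim linear.\<close>
  have linear: "x / 2 + a + g / 32 - T \<le> S / 2 + A / 2"
    if "m / 2 + (4 * a - 4 * b + 2 * d - 24 * q) \<le> S" "0 \<le> m / 2 - x / 2 - b + a" "b - d \<le> r" "T = r + 12 * q"
    for a b d r :: real
    using that A by linarith
  have "4 * k * (x - (m - m1) - m1 / 2 - p) = 4 * (k * x) - 4 * (k * m) + 2 * (k * m1) - 4 * (k * p)"
    by (simp add: algebra_simps)
  then have "m / 2 + (4 * (k * x) - 4 * (k * m) + 2 * (k * m1) - 24 * q) \<le> S"
    using S by (simp only: p)
  moreover have "(m - x) * (1/2 - k) = m / 2 - x / 2 - k * m + k * x"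
    by (simp add: algebra_simps diff_divide_distrib)
  then have "0 \<le> m / 2 - x / 2 - k * m + k * x" using slack by simp
  moreover have "k * m - k * m1 \<le> k * D" using D by (simp only: right_diff_distrib)
  ultimately have "x / 2 + k * x + g / 32 - T \<le> S / 2 + A / 2" using T by (rule linear)
  then show ?thesis by (simp add: distrib_right)
qed

text \<open>The loss is written vertex by vertex, ready for averaging over the noise. The bounds on
  \<open>c\<close> and \<open>eps\<close> make \<open>4 * c * eps\<close> an admissible
  weight.\<close>

lemma expectation_out_ge:
  fixes eps c :: real
  assumes G: "simple_graph n E" "triangle_free E" and C: "C \<subseteq> {..<n}"
    and eps: "0 < eps" "eps \<le> 1" and c: "0 \<le> c" "c \<le> 1/4"
  shows "(1/2 + c * eps) * OPT n E + (\<Sum>v<n. deg E v * center_prob (eps / 6) (deg E v)) / 32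
      - (\<Sum>v<n. c * (eps * deg E v * (if v \<in> C then 0 else 1) + 12 * (if v \<in> C \<and> 0 < deg E v then 1 else 0)))
    \<le> measure_pmf.expectation (out_pmf n E eps C) (\<lambda>S. real (val E S))"
proof -
  let ?f = "\<lambda>S. real (val E S)"
  let ?m = "real (card E)" and ?m1 = "real (card (induced_edges E C))" and ?O = "real (OPT n E)"
  let ?k = "c * eps" and ?g = "\<Sum>v<n. deg E v * center_prob (eps / 6) (deg E v)"
  let ?P = "card {v\<in>C. 0 < deg E v}"
  let ?D = "\<Sum>v<n. real (deg E v) * (if v \<in> C then 0 else 1)"
  have finE: "finite E" using G(1) by (rule simple_graph_finite)
  have k: "0 \<le> ?k" "?k \<le> 1/4"
    using c eps mult_mono[of c "1/4" eps 1] by auto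
  have fin: "finite (set_pmf (S1_pmf n E eps C))" "finite (set_pmf (alg_A n E (eps / 3)))"
    using set_S1_pmf[OF C, of E eps] set_alg_A[of n E "eps / 6"]
    by (auto intro: finite_subset[OF _ finite_cuts[OF finite_lessThan]])
  have "measure_pmf.expectation (out_pmf n E eps C) ?f =
      (\<Sum>b\<in>UNIV. pmf (bernoulli_pmf (1/2)) b *\<^sub>R
        measure_pmf.expectation (if b then S1_pmf n E eps C else alg_A n E (eps / 3)) ?f)"
    unfolding out_pmf_def by (rule pmf_expectation_bind) (use fin in auto)
  also have "\<dots> = measure_pmf.expectation (S1_pmf n E eps C) ?f / 2 + measure_pmf.expectation (alg_A n E (eps / 3)) ?f / 2"
    by (simp add: UNIV_bool)
  finally have split: "measure_pmf.expectation (out_pmf n E eps C) ?f =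
    measure_pmf.expectation (S1_pmf n E eps C) ?f / 2 + measure_pmf.expectation (alg_A n E (eps / 3)) ?f / 2" .
  have A: "?m / 2 + ?g / 16 \<le> measure_pmf.expectation (alg_A n E (eps / 3)) ?f"
    using expectation_val_alg_A[OF G, of "eps / 6"] eps by simp
  have S: "?m / 2 + 4 * ?k * (?O - (?m - ?m1) - ?m1 / 2 - 6 / eps * ?P) \<le>
      measure_pmf.expectation (S1_pmf n E eps C) ?f"
    by (rule expectation_val_S1_ge[OF G(1) C eps(1)]) (use k in auto)
  have "?O \<le> ?m"
    using OPT_attained[of n E] val_le_card[OF finE] by (metis of_nat_mono)
  then have "0 \<le> (?m - ?O) * (1/2 - ?k)" using k by (intro mult_nonneg_nonneg) auto
  moreover have "?k * (?m - ?m1) \<le> ?k * ?D"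
    using card_uninduced_le[OF G(1), of C] k by (intro mult_left_mono) auto
  moreover have "?k * (6 / eps * ?P) = 6 * (c * ?P)" using eps by simp
  moreover have "(\<Sum>v<n. c * (eps * deg E v * (if v \<in> C then 0 else 1) + 12 * (if v \<in> C \<and> 0 < deg E v then 1 else 0)))
      = ?k * ?D + 12 * (c * ?P)"
  proof -
    have "{..<n} \<inter> {v. v \<in> C \<and> 0 < deg E v} = {v\<in>C. 0 < deg E v}" using C by auto
    then have "(\<Sum>v<n. if v \<in> C \<and> 0 < deg E v then 1 else 0) = real ?P"
      by (simp add: sum.If_cases)
    then show ?thesis
      by (simp only: distrib_left sum.distrib sum_distrib_left[symmetric] mult.assoc)
  qed
  ultimately show ?thesis
    unfolding split by (intro combine_bounds[OF A S])
qed

section \<open>Averaging over the Laplace noise\<close>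

text \<open>The loss for fixed \<open>C\<close> is affine in the membership indicators, so its mean
  at a vertex involves a single Laplace variable and \<open>vertex_tradeoff\<close> pays for
  it.\<close>

lemma expected_val_ge:
  fixes eps c :: real
  assumes G: "simple_graph n E" "triangle_free E" and eps: "0 < eps" "eps \<le> 1"
    and c: "c = exp (- 24) / 10000"
  shows "(1/2 + c * eps) * real (OPT n E) \<le> expected_val n E eps"
proof -
  let ?l = "lap (3 / eps)" and ?T = "10000 / eps\<^sup>2"
  let ?M = "PiM {..<n} (\<lambda>_. ?l)"
  let ?gain = "\<lambda>v. real (deg E v) * center_prob (eps / 6) (deg E v)"
  let ?K = "(1/2 + c * eps) * OPT n E + (\<Sum>v<n. ?gain v) / 32"
  let ?F = "\<lambda>C. measure_pmf.expectation (out_pmf n E eps C) (\<lambda>S. real (val E S))"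
  let ?In = "\<lambda>v. {\<omega>\<in>space ?M. real (deg E v) + \<omega> v > ?T}"
  let ?pin = "\<lambda>d. measure ?l {x. real d + x > ?T}"
  let ?cost = "\<lambda>v \<omega>. c * (eps * deg E v * (1 - indicator (?In v) \<omega>) + 12 * (if 0 < deg E v then indicator (?In v) \<omega> else 0)) :: real"
  let ?mean = "\<lambda>v. c * (eps * deg E v * (1 - ?pin (deg E v)) + 12 * (if 0 < deg E v then ?pin (deg E v) else 0))"
  let ?L = "\<lambda>\<omega>. ?K - (\<Sum>v<n. ?cost v \<omega>)"
  have b: "0 < 3 / eps" using eps by simp
  have c01: "0 \<le> c" "c \<le> 1/4"
  proof -
    have "exp (- 24 :: real) \<le> 1" by simp
    then show "c \<le> 1/4" unfolding c by linarith
  qed (simp add: c)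
  interpret l: prob_space ?l using b by (rule prob_space_lap)
  interpret M: prob_space ?M by (rule prob_space_PiM) (rule l.prob_space_axioms)
  have finE: "finite E" using G(1) by (rule simple_graph_finite)
  have comp: "(\<lambda>\<omega>. \<omega> v) \<in> borel_measurable ?M" if "v \<in> {..<n}" for v
    using measurable_component_singleton[OF that, of "\<lambda>_. ?l"] by (simp cong: measurable_cong_sets)
  have In: "?In v \<in> sets ?M" if "v < n" for v
  proof -
    have [measurable]: "(\<lambda>\<omega>. \<omega> v) \<in> borel_measurable ?M" using that by (intro comp) simp
    show ?thesis by measurable
  qed
  have prob_In: "M.prob (?In v) = ?pin (deg E v)" if "v < n" for v
  proof -
    have "?l = distr ?M ?l (\<lambda>\<omega>. \<omega> v)"
      using that by (intro distr_PiM_component[symmetric] l.prob_space_axioms) simp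
    then have "?pin (deg E v) = measure (distr ?M ?l (\<lambda>\<omega>. \<omega> v)) {x. real (deg E v) + x > ?T}"
      by simp
    also have "\<dots> = M.prob ((\<lambda>\<omega>. \<omega> v) -` {x. real (deg E v) + x > ?T} \<inter> space ?M)"
      using that by (intro measure_distr) auto
    also have "\<dots> = M.prob (?In v)"
      by (rule arg_cong[of _ _ M.prob]) auto
    finally show ?thesis by simp
  qed
  have vertex: "?mean v \<le> ?gain v / 32" for v
  proof (cases "deg E v = 0")
    case False
    let ?d = "deg E v"
    have "c * (eps * ?d * (1 - ?pin ?d) + 12 * ?pin ?d) \<le> ?gain v / 32"
      unfolding c
    proof (rule vertex_tradeoff[OF eps])
      \<comment> \<open>Below half the cutoff, entering \<open>C\<close> needs noise above
        \<open>5000 / eps^2\<close>.\<close>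
      assume d: "real ?d < 5000 / eps\<^sup>2"
      have "?pin ?d \<le> measure ?l {x. 5000 / eps\<^sup>2 \<le> \<bar>x\<bar>}"
        using d by (intro l.finite_measure_mono) auto
      also have "\<dots> \<le> (3 / eps) / (5000 / eps\<^sup>2)"
        using b eps by (intro lap_tail) auto
      also have "\<dots> \<le> eps" using eps by (simp add: power2_eq_square)
      finally show "?pin ?d \<le> eps" .
    next
      \<comment> \<open>Above twice the cutoff, staying outside \<open>C\<close> needs noise below
        \<open>- d / 2\<close>.\<close>
      assume d: "20000 / eps\<^sup>2 < real ?d"
      have "1 - ?pin ?d = measure ?l (space ?l - {x. real ?d + x > ?T})"
        by (subst l.prob_compl) auto
      also have "\<dots> \<le> measure ?l {x. real ?d / 2 \<le> \<bar>x\<bar>}"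
        using d by (intro l.finite_measure_mono) auto
      also have "\<dots> \<le> (3 / eps) / (real ?d / 2)"
        using b False by (intro lap_tail) auto
      also have "\<dots> = 6 / (eps * ?d)" using eps by simp
      finally show "1 - ?pin ?d \<le> 6 / (eps * ?d)" .
    qed (use False in auto)
    then show ?thesis using False by simp
  qed simp
  have sub: "noisy_C n E eps \<omega> \<subseteq> {..<n}" for \<omega> by (auto simp: noisy_C_def)
  have mem: "v \<in> noisy_C n E eps \<omega> \<longleftrightarrow> \<omega> \<in> ?In v" if "v < n" "\<omega> \<in> space ?M" for v \<omega>
    using that by (simp add: noisy_C_def)
  have int_F: "integrable ?M (\<lambda>\<omega>. ?F (noisy_C n E eps \<omega>))"
  proof (rule M.integrable_const_bound[of _ "real (card E)"])
    have "\<bar>?F C\<bar> \<le> card E" for C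
    proof -
      have bd: "0 \<le> real (val E S)" "real (val E S) \<le> card E" for S
        using val_le_card[OF finE] by auto
      have "integrable (out_pmf n E eps C) (\<lambda>S. real (val E S))"
        by (rule measure_pmf.integrable_const_bound[of _ "real (card E)"]) (use bd in auto)
      then have "?F C \<le> card E" using bd by (intro measure_pmf.integral_le_const) auto
      moreover have "0 \<le> ?F C" using bd by (intro integral_nonneg_AE) auto
      ultimately show ?thesis by simp
    qed
    then show "AE \<omega> in ?M. norm (?F (noisy_C n E eps \<omega>)) \<le> card E" by simp
    \<comment> \<open>\<open>noisy_C\<close> takes finitely many values, and each fibre is a finite
      intersection of the events \<open>?In v\<close> and their complements.\<close>
    have "noisy_C n E eps \<in> measurable ?M (count_space (Pow {..<n}))"
      unfolding measurable_count_space_eq2[OF finite_Pow_iff[THEN iffD2, OF finite_lessThan]]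
    proof (intro conjI ballI)
      show "noisy_C n E eps \<in> space ?M \<rightarrow> Pow {..<n}" using sub by blast
      fix C assume C: "C \<in> Pow {..<n}"
      let ?B = "\<lambda>v. if v \<in> C then ?In v else space ?M - ?In v"
      have "noisy_C n E eps -` {C} \<inter> space ?M = space ?M \<inter> (\<Inter>v\<in>{..<n}. ?B v)"
      proof (intro set_eqI iffI)
        fix \<omega> assume "\<omega> \<in> noisy_C n E eps -` {C} \<inter> space ?M"
        then have "C = noisy_C n E eps \<omega>" "\<omega> \<in> space ?M" by blast+
        moreover from this have "\<omega> \<in> ?B v" if "v < n" for v
          using mem[OF that, of \<omega>] by simp
        ultimately show "\<omega> \<in> space ?M \<inter> (\<Inter>v\<in>{..<n}. ?B v)"
          by (intro IntI INT_I) (blast, simp only: lessThan_iff)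
      next
        fix \<omega> assume w: "\<omega> \<in> space ?M \<inter> (\<Inter>v\<in>{..<n}. ?B v)"
        have "v \<in> noisy_C n E eps \<omega> \<longleftrightarrow> v \<in> C" for v
        proof (cases "v < n")
          case True
          then have "\<omega> \<in> ?B v" using w by blast
          then show ?thesis using mem[OF True, of \<omega>] w by (simp split: if_splits)
        next
          case False
          then show ?thesis using C sub[of \<omega>] by blast
        qed
        then show "\<omega> \<in> noisy_C n E eps -` {C} \<inter> space ?M" using w by blast
      qed
      also have "\<dots> \<in> sets ?M"
      \<comment> \<open>The rule for finite intersections asks for a non-empty index set; for
        \<open>n = 0\<close> the fibre is the whole space.\<close>
      proof (cases "n = 0")
        case False
        then show ?thesis using In by (intro sets.Int sets.finite_INT) auto
      qed simp
      finally show "noisy_C n E eps -` {C} \<inter> space ?M \<in> sets ?M" .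
    qed
    then show "(\<lambda>\<omega>. ?F (noisy_C n E eps \<omega>)) \<in> borel_measurable ?M"
      by (rule measurable_compose) simp
  qed
  have int_ind: "integrable ?M (indicator (?In v) :: _ \<Rightarrow> real)" if "v < n" for v
    using In[OF that] by (simp add: less_top[symmetric])
  have int_term: "integrable ?M (?cost v)"
    if "v < n" for v
    using int_ind[OF that] by (cases "0 < deg E v") auto
  have integral_term: "(\<integral>\<omega>. ?cost v \<omega> \<partial>?M) =
      ?mean v"
    if "v < n" for v
    using int_ind[OF that] In[OF that] prob_In[OF that]
    by (cases "0 < deg E v") (auto simp: M.prob_space)
  have "(1/2 + c * eps) * OPT n E \<le> ?K - (\<Sum>v<n. ?mean v)"
  proof -
    have "(\<Sum>v<n. ?mean v)
        \<le> (\<Sum>v<n. ?gain v / 32)"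
      by (rule sum_mono) (rule vertex)
    then show ?thesis by (simp only: sum_divide_distrib[symmetric])
  qed
  also have "\<dots> = (\<integral>\<omega>. ?L \<omega> \<partial>?M)"
  proof -
    have "(\<integral>\<omega>. ?L \<omega> \<partial>?M) = ?K - (\<Sum>v<n. \<integral>\<omega>. ?cost v \<omega> \<partial>?M)"
      using int_term
      by (subst Bochner_Integration.integral_diff; (subst Bochner_Integration.integral_sum)?)
        (auto simp: M.prob_space intro!: Bochner_Integration.integrable_sum)
    also have "\<dots> = ?K - (\<Sum>v<n. ?mean v)"
      by (intro arg_cong2[of _ _ _ _ "(-)"] sum.cong refl integral_term) simp
    finally show ?thesis ..
  qed
  also have "\<dots> \<le> (\<integral>\<omega>. ?F (noisy_C n E eps \<omega>) \<partial>?M)"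
  proof (rule integral_mono[OF _ int_F])
    show "integrable ?M ?L"
      using int_term by (intro Bochner_Integration.integrable_diff Bochner_Integration.integrable_sum) auto
    fix \<omega> assume w: "\<omega> \<in> space ?M"
    let ?C = "noisy_C n E eps \<omega>"
    have "?L \<omega> = ?K - (\<Sum>v<n. c * (eps * deg E v * (if v \<in> ?C then 0 else 1) + 12 * (if v \<in> ?C \<and> 0 < deg E v then 1 else 0)))"
      by (intro arg_cong2[of _ _ _ _ "(-)"] sum.cong refl) (simp add: mem[OF _ w] indicator_def del: mem_Collect_eq)
    then show "?L \<omega> \<le> ?F ?C"
      using expectation_out_ge[OF G sub eps c01] by simp
  qed
  also have "\<dots> = expected_val n E eps" by (simp add: expected_val_def)
  finally show ?thesis .
qed

theorem theorem5p7:
  shows "\<exists>c0 > 0. \<exists>c > (0::real). \<forall>eps::real. 0 < eps \<and> eps \<le> c0 \<longrightarrow>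
           (\<forall>n E. simple_graph n E \<and> triangle_free E \<longrightarrow>
              expected_val n E eps \<ge> (1/2 + c * eps) * real (OPT n E))"
proof (intro exI conjI allI impI)
  fix eps :: real and n E
  \<comment> \<open>The witnesses are fixed here by unification: \<open>c0 = 1\<close> and
    \<open>c = exp (- 24) / 10000\<close>.\<close>
  assume "0 < eps \<and> eps \<le> 1" "simple_graph n E \<and> triangle_free E"
  then show "(1/2 + exp (- 24) / 10000 * eps) * real (OPT n E) \<le> expected_val n E eps"
    by (intro expected_val_ge) auto
qed auto

end
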